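(* Let $f\colon\Gamma\to G$ be a group homomorphism. There is a natural exact sequence $$0\longrightarrow\frac{H_2(G)}{f_*H_2(\Gamma)}\longrightarrow H_2(G,\Gamma)\longrightarrow\ker\bigl(H_1(\Gamma)\to H_1(G)\bigr)\longrightarrow0.$$ In particular, if $f_*\colon H_1(\Gamma)\to H_1(G)$ is injective, then $$\frac{H_2(G)}{f_*H_2(\Gamma)}\cong H_2(G,\Gamma).$$
   Context: All homology is with $\mathbb Z$ coefficients. $H_*(G,\Gamma)$ denotes the (relative) homology of the mapping cone of the map of classifying spaces $Bf\colon B\Gamma\to BG$ induced by $f$. *)

theory Defs
  imports "HOL-Homology.Homology"
begin

section \<open>Classifying spaces\<close>

definition quotient_topology :: "'a topology \<Rightarrow> ('a \<Rightarrow> 'b) \<Rightarrow> 'b topology" where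
  "quotient_topology X q =
     topology (\<lambda>U. U \<subseteq> q ` topspace X \<and> openin X {x \<in> topspace X. q x \<in> U})"

text \<open>
  The nerve of \<open>G\<close> has as \<open>n\<close>-simplices the lists \<open>[g1, ..., gn]\<close>, read as strings of
  composable arrows between the vertices \<open>0, ..., n\<close>.
\<close>

definition bar_face :: "('a, 'm) monoid_scheme \<Rightarrow> nat \<Rightarrow> 'a list \<Rightarrow> 'a list" where
  "bar_face G i gs =
     (if i = 0 then tl gs
      else if i = length gs then butlast gs
      else take (i - 1) gs @ [gs ! (i - 1) \<otimes>\<^bsub>G\<^esub> gs ! i] @ drop (i + 1) gs)"

definition bar_degeneracy :: "('a, 'm) monoid_scheme \<Rightarrow> nat \<Rightarrow> 'a list \<Rightarrow> 'a list" where
  "bar_degeneracy G i gs = take i gs @ [\<one>\<^bsub>G\<^esub>] @ drop i gs"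

text \<open>Collapse of the edge from vertex \<open>i\<close> to vertex \<open>i + 1\<close>, in barycentric coordinates;
  the dual coface map is \<^const>\<open>simplical_face\<close>.\<close>

definition simplicial_collapse :: "nat \<Rightarrow> (nat \<Rightarrow> real) \<Rightarrow> nat \<Rightarrow> real" where
  "simplicial_collapse i t =
     (\<lambda>j. if j < i then t j else if j = i then t i + t (Suc i) else t (Suc j))"

type_synonym 'a bar_point = "'a list \<times> (nat \<Rightarrow> real)"

text \<open>
  The disjoint union over \<open>n\<close> of the spaces \<open>G^n \<times> \<Delta>^n\<close> (with \<open>G^n\<close> discrete). The summand
  to which a point belongs is recorded by the length of its list.
\<close>

definition bar_space :: "('a, 'm) monoid_scheme \<Rightarrow> 'a bar_point topology" where
  "bar_space G =
     subtopology
       (prod_topology (discrete_topology (lists (carrier G))) (powertop_real UNIV))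
       {(gs, t). t \<in> standard_simplex (length gs)}"

inductive_set bar_step :: "('a, 'm) monoid_scheme \<Rightarrow> ('a bar_point \<times> 'a bar_point) set"
  for G :: "('a, 'm) monoid_scheme" where
  face: "\<lbrakk>gs \<in> lists (carrier G); length gs = Suc n; i \<le> Suc n; t \<in> standard_simplex n\<rbrakk>
     \<Longrightarrow> ((bar_face G i gs, t), (gs, simplical_face i t)) \<in> bar_step G"
| degeneracy: "\<lbrakk>gs \<in> lists (carrier G); length gs = n; i \<le> n; t \<in> standard_simplex (Suc n)\<rbrakk>
     \<Longrightarrow> ((bar_degeneracy G i gs, t), (gs, simplicial_collapse i t)) \<in> bar_step G"

definition bar_equiv :: "('a, 'm) monoid_scheme \<Rightarrow> ('a bar_point \<times> 'a bar_point) set" where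
  "bar_equiv G =
     (bar_step G \<union> (bar_step G)\<inverse>)\<^sup>* \<inter> (topspace (bar_space G) \<times> topspace (bar_space G))"

definition bar_class :: "('a, 'm) monoid_scheme \<Rightarrow> 'a bar_point \<Rightarrow> 'a bar_point set" where
  "bar_class G p = bar_equiv G `` {p}"

text \<open>\<open>BG\<close>: the geometric realization of the nerve of \<open>G\<close>.\<close>

definition classifying_space :: "('a, 'm) monoid_scheme \<Rightarrow> 'a bar_point set topology" where
  "classifying_space G = quotient_topology (bar_space G) (bar_class G)"

text \<open>\<open>Bf\<close>, sending the class of \<open>([g1, ..., gn], t)\<close> to that of \<open>([f g1, ..., f gn], t)\<close>;
  see \<open>classifying_map_bar_class\<close> below.\<close>

definition classifying_map ::
  "('b, 'n) monoid_scheme \<Rightarrow> ('a \<Rightarrow> 'b) \<Rightarrow> 'a bar_point set \<Rightarrow> 'b bar_point set" where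
  "classifying_map G f c = bar_equiv G `` (map_prod (map f) id ` c)"


section \<open>Mapping cones\<close>

text \<open>
  The cone of \<open>h : X \<rightarrow> Y\<close> is the quotient of the disjoint union of \<open>Y\<close>, \<open>X \<times> [0,1]\<close> and
  a point \<open>Apex\<close> that glues \<open>(x, 0)\<close> to \<open>h x\<close> and \<open>(x, 1)\<close> to \<open>Apex\<close>. Every point of this quotient
  has exactly one of the forms \<open>Base y\<close>, \<open>Mid x t\<close> with \<open>0 < t < 1\<close>, \<open>Apex\<close>.
\<close>

datatype ('x, 'y) cone_pt = Base 'y | Mid (mid_fst: 'x) real | Apex

definition cone_glue :: "('x \<Rightarrow> 'y) \<Rightarrow> 'x \<times> real \<Rightarrow> ('x, 'y) cone_pt" where
  "cone_glue h = (\<lambda>(x, t). if t = 0 then Base (h x) else if t = 1 then Apex else Mid x t)"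

definition cone_points :: "'x topology \<Rightarrow> 'y topology \<Rightarrow> ('x, 'y) cone_pt set" where
  "cone_points X Y =
     Base ` topspace Y \<union> {Mid x t |x t. x \<in> topspace X \<and> 0 < t \<and> t < 1} \<union> {Apex}"

definition mapping_cone ::
  "'x topology \<Rightarrow> 'y topology \<Rightarrow> ('x \<Rightarrow> 'y) \<Rightarrow> ('x, 'y) cone_pt topology" where
  "mapping_cone X Y h =
     topology (\<lambda>U. U \<subseteq> cone_points X Y \<and>
       openin Y {y \<in> topspace Y. Base y \<in> U} \<and>
       openin (prod_topology X (top_of_set {0..1}))
         {p \<in> topspace X \<times> {0..1}. cone_glue h p \<in> U})"


section \<open>Group homology\<close>

definition group_homology :: "int \<Rightarrow> ('a, 'm) monoid_scheme \<Rightarrow> 'a bar_point set chain set monoid"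
  where "group_homology p G = homology_group p (classifying_space G)"

definition group_homology_map ::
  "int \<Rightarrow> ('a, 'm) monoid_scheme \<Rightarrow> ('b, 'n) monoid_scheme \<Rightarrow> ('a \<Rightarrow> 'b)
    \<Rightarrow> 'a bar_point set chain set \<Rightarrow> 'b bar_point set chain set" where
  "group_homology_map p \<Gamma> G f =
     hom_induced p (classifying_space \<Gamma>) {} (classifying_space G) {} (classifying_map G f)"

type_synonym ('a, 'b) group_cone_pt = "('a bar_point set, 'b bar_point set) cone_pt"

definition group_cone ::
  "('a, 'm) monoid_scheme \<Rightarrow> ('b, 'n) monoid_scheme \<Rightarrow> ('a \<Rightarrow> 'b) \<Rightarrow> ('a, 'b) group_cone_pt topology"
  where "group_cone \<Gamma> G f =
     mapping_cone (classifying_space \<Gamma>) (classifying_space G) (classifying_map G f)"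

text \<open>\<open>H_p(G, \<Gamma>)\<close>: the homology of the mapping cone of \<open>Bf\<close>, relative to the cone point.\<close>

definition rel_group_homology ::
  "int \<Rightarrow> ('a, 'm) monoid_scheme \<Rightarrow> ('b, 'n) monoid_scheme \<Rightarrow> ('a \<Rightarrow> 'b)
    \<Rightarrow> ('a, 'b) group_cone_pt chain set monoid" where
  "rel_group_homology p \<Gamma> G f = relative_homology_group p (group_cone \<Gamma> G f) {Apex}"

text \<open>The map \<open>H_p(G, \<Gamma>) \<rightarrow> H_p(G', \<Gamma>')\<close> induced by a commutative square
  \<open>\<psi> \<circ> f = f' \<circ> \<phi>\<close> with \<open>\<phi> : \<Gamma> \<rightarrow> \<Gamma>'\<close> and \<open>\<psi> : G \<rightarrow> G'\<close>.\<close>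

definition rel_group_homology_map ::
  "int \<Rightarrow> ('a, 'm) monoid_scheme \<Rightarrow> ('b, 'n) monoid_scheme \<Rightarrow> ('a \<Rightarrow> 'b)
    \<Rightarrow> ('c, 'k) monoid_scheme \<Rightarrow> ('d, 'l) monoid_scheme \<Rightarrow> ('c \<Rightarrow> 'd)
    \<Rightarrow> ('a \<Rightarrow> 'c) \<Rightarrow> ('b \<Rightarrow> 'd)
    \<Rightarrow> ('a, 'b) group_cone_pt chain set \<Rightarrow> ('c, 'd) group_cone_pt chain set" where
  "rel_group_homology_map p \<Gamma> G f \<Gamma>' G' f' \<phi> \<psi> =
     hom_induced p (group_cone \<Gamma> G f) {Apex} (group_cone \<Gamma>' G' f') {Apex}
       (map_cone_pt (classifying_map \<Gamma>' \<phi>) (classifying_map G' \<psi>))"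


section \<open>The terms and maps of the exact sequence\<close>

definition H2_coker ::
  "('a, 'm) monoid_scheme \<Rightarrow> ('b, 'n) monoid_scheme \<Rightarrow> ('a \<Rightarrow> 'b)
    \<Rightarrow> 'b bar_point set chain set set monoid" where
  "H2_coker \<Gamma> G f =
     group_homology 2 G Mod (group_homology_map 2 \<Gamma> G f ` carrier (group_homology 2 \<Gamma>))"

definition H1_ker ::
  "('a, 'm) monoid_scheme \<Rightarrow> ('b, 'n) monoid_scheme \<Rightarrow> ('a \<Rightarrow> 'b)
    \<Rightarrow> 'a bar_point set chain set monoid" where
  "H1_ker \<Gamma> G f =
     subgroup_generated (group_homology 1 \<Gamma>)
       (kernel (group_homology 1 \<Gamma>) (group_homology 1 G) (group_homology_map 1 \<Gamma> G f))"

text \<open>The map of cokernels induced by \<open>\<psi>\<close>, sending the coset of \<open>x\<close> to that of its image.\<close>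

definition H2_coker_map ::
  "('b, 'n) monoid_scheme \<Rightarrow> ('c, 'k) monoid_scheme \<Rightarrow> ('d, 'l) monoid_scheme \<Rightarrow> ('c \<Rightarrow> 'd)
    \<Rightarrow> ('b \<Rightarrow> 'd) \<Rightarrow> 'b bar_point set chain set set \<Rightarrow> 'd bar_point set chain set set" where
  "H2_coker_map G \<Gamma>' G' f' \<psi> S =
     (group_homology_map 2 \<Gamma>' G' f' ` carrier (group_homology 2 \<Gamma>'))
       <#>\<^bsub>group_homology 2 G'\<^esub> (group_homology_map 2 G G' \<psi> ` S)"

text \<open>The map on \<open>H_2(G) / f_* H_2(\<Gamma>)\<close> induced by the inclusion of \<open>BG\<close> into the cone.\<close>

definition H2_coker_incl ::
  "('a, 'm) monoid_scheme \<Rightarrow> ('b, 'n) monoid_scheme \<Rightarrow> ('a \<Rightarrow> 'b)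
    \<Rightarrow> 'b bar_point set chain set set \<Rightarrow> ('a, 'b) group_cone_pt chain set" where
  "H2_coker_incl \<Gamma> G f S =
     the_elem (hom_induced 2 (classifying_space G) {} (group_cone \<Gamma> G f) {Apex} Base ` S)"

text \<open>
  The connecting map \<open>H_2(G, \<Gamma>) \<rightarrow> H_1(\<Gamma>)\<close>. Let \<open>C\<close> be the cone, \<open>V = C - BG\<close>, \<open>W = C - Apex\<close>.
  Then \<open>V\<close> contracts to the apex, excision identifies \<open>H_2(W, W \<inter> V)\<close> with \<open>H_2(C, V)\<close>, and
  \<open>W \<inter> V\<close> is the open cylinder \<open>B\<Gamma> \<times> (0,1)\<close>. The map is the composite
  \<open>H_2(C, Apex) \<rightarrow> H_2(C, V) \<cong> H_2(W, W \<inter> V) \<rightarrow> H_1(W \<inter> V) \<rightarrow> H_1(B\<Gamma>)\<close>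
  whose third arrow is the boundary map and whose last arrow is induced by the projection.
\<close>

definition H2_connecting ::
  "('a, 'm) monoid_scheme \<Rightarrow> ('b, 'n) monoid_scheme \<Rightarrow> ('a \<Rightarrow> 'b)
    \<Rightarrow> ('a, 'b) group_cone_pt chain set \<Rightarrow> 'a bar_point set chain set" where
  "H2_connecting \<Gamma> G f z =
     (let C = group_cone \<Gamma> G f;
          V = topspace C - range Base;
          W = topspace C - {Apex};
          w = inv_into (carrier (relative_homology_group 2 (subtopology C W) (W \<inter> V)))
                (hom_induced 2 (subtopology C W) (W \<inter> V) C V id)
                (hom_induced 2 C {Apex} C V id z)
      in hom_induced 1 (subtopology C (W \<inter> V)) {} (classifying_space \<Gamma>) {} mid_fst
           (hom_boundary 2 (subtopology C W) (W \<inter> V) w))"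

text \<open>The library's \<open>short_exact_sequence\<close> requires all groups to have the same
  element type.\<close>

definition is_short_exact ::
  "('a, 'm) monoid_scheme \<Rightarrow> ('b, 'n) monoid_scheme \<Rightarrow> ('c, 'k) monoid_scheme
    \<Rightarrow> ('a \<Rightarrow> 'b) \<Rightarrow> ('b \<Rightarrow> 'c) \<Rightarrow> bool" where
  "is_short_exact A B C \<alpha> \<beta> \<longleftrightarrow>
     group A \<and> group B \<and> group C \<and> \<alpha> \<in> mon A B \<and> \<beta> \<in> epi B C \<and>
     \<alpha> ` carrier A = kernel B C \<beta>"


section \<open>Basic properties of the constructions\<close>

lemma openin_quotient_topology:
  "openin (quotient_topology X q) U \<longleftrightarrow>
     U \<subseteq> q ` topspace X \<and> openin X {x \<in> topspace X. q x \<in> U}"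
proof -
  have "istopology (\<lambda>U. U \<subseteq> q ` topspace X \<and> openin X {x \<in> topspace X. q x \<in> U})"
    unfolding istopology_def
  proof (intro conjI allI impI; (elim conjE)?)
    fix S T assume "openin X {x \<in> topspace X. q x \<in> S}" "openin X {x \<in> topspace X. q x \<in> T}"
    then have "openin X ({x \<in> topspace X. q x \<in> S} \<inter> {x \<in> topspace X. q x \<in> T})"
      by (rule openin_Int)
    moreover have "{x \<in> topspace X. q x \<in> S} \<inter> {x \<in> topspace X. q x \<in> T}
      = {x \<in> topspace X. q x \<in> S \<inter> T}" by blast
    ultimately show "openin X {x \<in> topspace X. q x \<in> S \<inter> T}" by simp
  next
    fix K assume K: "\<forall>S\<in>K. S \<subseteq> q ` topspace X \<and> openin X {x \<in> topspace X. q x \<in> S}"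
    have "openin X (\<Union>S\<in>K. {x \<in> topspace X. q x \<in> S})" using K by (intro openin_Union) auto
    moreover have "(\<Union>S\<in>K. {x \<in> topspace X. q x \<in> S}) = {x \<in> topspace X. q x \<in> \<Union>K}" by blast
    ultimately show "openin X {x \<in> topspace X. q x \<in> \<Union>K}" by simp
    show "\<Union>K \<subseteq> q ` topspace X" using K by blast
  qed blast
  then show ?thesis unfolding quotient_topology_def by (simp add: topology_inverse')
qed

lemma topspace_quotient_topology [simp]: "topspace (quotient_topology X q) = q ` topspace X"
proof
  show "topspace (quotient_topology X q) \<subseteq> q ` topspace X"
    using openin_quotient_topology[THEN iffD1, OF openin_topspace] by (rule conjunct1)
  have "{x \<in> topspace X. q x \<in> q ` topspace X} = topspace X" by blast
  then have "openin (quotient_topology X q) (q ` topspace X)"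
    by (simp add: openin_quotient_topology)
  then show "q ` topspace X \<subseteq> topspace (quotient_topology X q)" by (rule openin_subset)
qed

lemma quotient_map_quotient_topology: "quotient_map X (quotient_topology X q) q"
  by (auto simp: quotient_map_def openin_quotient_topology)

lemma openin_mapping_cone:
  fixes X :: "'x topology" and Y :: "'y topology"
  shows "openin (mapping_cone X Y h) U \<longleftrightarrow>
     U \<subseteq> cone_points X Y \<and>
     openin Y {y \<in> topspace Y. Base y \<in> U} \<and>
     openin (prod_topology X (top_of_set {0..1}))
       {p \<in> topspace X \<times> {0..1}. cone_glue h p \<in> U}"
proof -
  let ?Z = "prod_topology X (top_of_set {0..1::real})"
  let ?A = "\<lambda>U :: ('x, 'y) cone_pt set. {y \<in> topspace Y. Base y \<in> U}"
  let ?B = "\<lambda>U :: ('x, 'y) cone_pt set. {p \<in> topspace X \<times> {0..1}. cone_glue h p \<in> U}"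
  have "istopology (\<lambda>U. U \<subseteq> cone_points X Y \<and> openin Y (?A U) \<and> openin ?Z (?B U))"
    unfolding istopology_def
  proof (intro conjI allI impI; (elim conjE)?)
    fix S T assume "openin Y (?A S)" "openin Y (?A T)"
    then have "openin Y (?A S \<inter> ?A T)" by (rule openin_Int)
    moreover have "?A S \<inter> ?A T = ?A (S \<inter> T)" by blast
    ultimately show "openin Y (?A (S \<inter> T))" by simp
  next
    fix S T assume "openin ?Z (?B S)" "openin ?Z (?B T)"
    then have "openin ?Z (?B S \<inter> ?B T)" by (rule openin_Int)
    moreover have "?B S \<inter> ?B T = ?B (S \<inter> T)" by blast
    ultimately show "openin ?Z (?B (S \<inter> T))" by simp
  next
    fix K assume K: "\<forall>S\<in>K. S \<subseteq> cone_points X Y \<and> openin Y (?A S) \<and> openin ?Z (?B S)"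
    have "openin Y (\<Union>S\<in>K. ?A S)" "openin ?Z (\<Union>S\<in>K. ?B S)"
      using K by (auto intro!: openin_Union simp del: mem_Sigma_iff)
    moreover have "(\<Union>S\<in>K. ?A S) = ?A (\<Union>K)" "(\<Union>S\<in>K. ?B S) = ?B (\<Union>K)" by blast+
    ultimately show "openin Y (?A (\<Union>K))" "openin ?Z (?B (\<Union>K))" by simp_all
    show "\<Union>K \<subseteq> cone_points X Y" using K by blast
  qed blast
  then show ?thesis unfolding mapping_cone_def by (simp add: topology_inverse')
qed

lemma equiv_bar_equiv: "equiv (topspace (bar_space G)) (bar_equiv G)"
proof (rule equivI)
  have "sym ((bar_step G \<union> (bar_step G)\<inverse>)\<^sup>*)" by (intro sym_rtrancl sym_Un_converse)
  then show "sym (bar_equiv G)" unfolding bar_equiv_def sym_def by blast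
  show "trans (bar_equiv G)" unfolding bar_equiv_def by (rule transI) (auto intro: rtrancl_trans)
  show "refl_on (topspace (bar_space G)) (bar_equiv G)"
    by (auto simp: bar_equiv_def refl_on_def)
  show "bar_equiv G \<subseteq> topspace (bar_space G) \<times> topspace (bar_space G)"
    unfolding bar_equiv_def by (rule Int_lower2)
qed

lemma topspace_bar_space:
  "topspace (bar_space G) =
     {(gs, t). gs \<in> lists (carrier G) \<and> t \<in> standard_simplex (length gs)}"
  by (auto simp: bar_space_def)

lemma map_in_lists_carrier:
  assumes "f \<in> hom \<Gamma> G" "gs \<in> lists (carrier \<Gamma>)"
  shows "map f gs \<in> lists (carrier G)"
  using assms by (auto simp: hom_def Pi_iff in_lists_conv_set)

lemma map_bar_step:
  assumes "f \<in> hom \<Gamma> G" "group \<Gamma>" "group G" "((gs, t), (gs', t')) \<in> bar_step \<Gamma>"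
  shows "((map f gs, t), (map f gs', t')) \<in> bar_step G"
  using assms(4)
proof (cases rule: bar_step.cases)
  case (face n i)
  have "f (gs' ! (i - 1) \<otimes>\<^bsub>\<Gamma>\<^esub> gs' ! i) = f (gs' ! (i - 1)) \<otimes>\<^bsub>G\<^esub> f (gs' ! i)"
    if "i \<noteq> 0" "i \<noteq> Suc n"
    using that face assms(1) by (intro hom_mult) (auto simp: in_lists_conv_set)
  then have "map f (bar_face \<Gamma> i gs') = bar_face G i (map f gs')"
    using face by (simp add: bar_face_def map_tl map_butlast take_map drop_map)
  moreover have "map f gs' \<in> lists (carrier G)"
    using map_in_lists_carrier[OF assms(1)] face by simp
  ultimately show ?thesis using face bar_step.face[of "map f gs'" G n i t] by simp
next
  case (degeneracy n i)
  have "map f (bar_degeneracy \<Gamma> i gs') = bar_degeneracy G i (map f gs')"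
    using assms by (simp add: bar_degeneracy_def take_map drop_map hom_one)
  moreover have "map f gs' \<in> lists (carrier G)"
    using map_in_lists_carrier[OF assms(1)] degeneracy by simp
  ultimately show ?thesis using degeneracy bar_step.degeneracy[of "map f gs'" G n i t] by simp
qed

lemma map_bar_equiv:
  assumes "f \<in> hom \<Gamma> G" "group \<Gamma>" "group G" "(p, q) \<in> bar_equiv \<Gamma>"
  shows "(map_prod (map f) id p, map_prod (map f) id q) \<in> bar_equiv G"
proof -
  let ?m = "map_prod (map f) id"
  have "(p, q) \<in> (bar_step \<Gamma> \<union> (bar_step \<Gamma>)\<inverse>)\<^sup>*"
    using assms(4) by (simp add: bar_equiv_def)
  then have "(?m p, ?m q) \<in> (bar_step G \<union> (bar_step G)\<inverse>)\<^sup>*"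
  proof induction
    case (step y z)
    then have "(?m y, ?m z) \<in> bar_step G \<union> (bar_step G)\<inverse>"
      using map_bar_step[OF assms(1-3)] by (cases y; cases z) auto
    then show ?case using step.IH by (rule rtrancl.rtrancl_into_rtrancl[rotated])
  qed simp
  moreover have "?m r \<in> topspace (bar_space G)" if "r \<in> topspace (bar_space \<Gamma>)" for r
    using that assms(1) by (auto simp: topspace_bar_space hom_def Pi_iff)
  ultimately show ?thesis using assms(4) by (auto simp: bar_equiv_def)
qed

lemma classifying_map_bar_class:
  assumes "f \<in> hom \<Gamma> G" "group \<Gamma>" "group G" "p \<in> topspace (bar_space \<Gamma>)"
  shows "classifying_map G f (bar_class \<Gamma> p) = bar_class G (map_prod (map f) id p)"
proof -
  have "(p, p) \<in> bar_equiv \<Gamma>"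
    using equiv_bar_equiv assms(4) by (metis equivE refl_onD)
  moreover have "bar_equiv G `` {map_prod (map f) id q} = bar_equiv G `` {map_prod (map f) id p}"
    if "(p, q) \<in> bar_equiv \<Gamma>" for q
    using equiv_class_eq[OF equiv_bar_equiv map_bar_equiv[OF assms(1-3) that]] by simp
  ultimately have "(\<Union>q\<in>bar_equiv \<Gamma> `` {p}. bar_equiv G `` {map_prod (map f) id q}) =
      bar_equiv G `` {map_prod (map f) id p}"
    by blast
  then show ?thesis
    by (simp only: classifying_map_def bar_class_def Image_eq_UN[of _ "_ ` _"] UN_simps image_image)
qed

lemma continuous_map_classifying_map:
  assumes "f \<in> hom \<Gamma> G" "group \<Gamma>" "group G"
  shows "continuous_map (classifying_space \<Gamma>) (classifying_space G) (classifying_map G f)"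
proof -
  let ?m = "map_prod (map f) id"
  have lists: "map f \<in> lists (carrier \<Gamma>) \<rightarrow> lists (carrier G)"
    using map_in_lists_carrier[OF assms(1)] by blast
  have "continuous_map
      (prod_topology (discrete_topology (lists (carrier \<Gamma>))) (powertop_real UNIV))
      (prod_topology (discrete_topology (lists (carrier G))) (powertop_real UNIV))
      (\<lambda>(x, y). (map f x, id y))"
    unfolding continuous_map_prod_top
    using lists by (intro disjI2 conjI) simp_all
  then have "continuous_map
      (prod_topology (discrete_topology (lists (carrier \<Gamma>))) (powertop_real UNIV))
      (prod_topology (discrete_topology (lists (carrier G))) (powertop_real UNIV)) ?m"
    by (simp only: map_prod_def)
  then have "continuous_map (bar_space \<Gamma>) (bar_space G) ?m"
    unfolding bar_space_def
    by (intro continuous_map_into_subtopology continuous_map_from_subtopology)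
      (auto simp: Pi_iff)
  moreover have "continuous_map (bar_space G) (classifying_space G) (bar_class G)"
    unfolding classifying_space_def
    by (rule quotient_imp_continuous_map[OF quotient_map_quotient_topology])
  ultimately have "continuous_map (bar_space \<Gamma>) (classifying_space G) (bar_class G \<circ> ?m)"
    by (rule continuous_map_compose)
  then have "continuous_map (bar_space \<Gamma>) (classifying_space G)
      (classifying_map G f \<circ> bar_class \<Gamma>)"
    by (rule continuous_map_eq) (simp add: classifying_map_bar_class[OF assms])
  then show ?thesis
    unfolding classifying_space_def[of \<Gamma>]
    by (rule continuous_compose_quotient_map[OF quotient_map_quotient_topology])
qed

end

theory Submission
  imports Defs "HOL-Analysis.Abstract_Topological_Spaces"
begin

text \<open>
  The sequence is a piece of the long exact homology sequence of a mapping cone (the Puppe sequence).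
  It holds in every degree for the cone \<open>C\<close> of an arbitrary continuous \<open>h : X \<rightarrow> Y\<close>; of group theory
  it uses only that homomorphisms induce continuous maps of classifying spaces, functorially.

  Removing the apex from \<open>C\<close> leaves an open set, the body, which deformation retracts onto \<open>Y\<close>.
  Removing \<open>Y\<close> leaves an open set, the cap, which contracts to the apex. The two meet in the collar
  \<open>X \<times> (0,1)\<close>, which is homotopy equivalent to \<open>X\<close>. Hence the homology sequence of the pair (body, collar)
  already has the groups of \<open>Y\<close> and \<open>X\<close> as its absolute terms, and its relative term is that of
  \<open>(C, Apex)\<close>: excision of the apex gives \<open>H(body, collar) \<cong> H(C, cap)\<close> (\<open>excision_iso\<close>), and
  \<open>H(C, Apex) \<cong> H(C, cap)\<close> because the cap is contractible (\<open>Apex_cap_iso\<close>). Under these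
  identifications the inclusion of the collar into the body becomes \<open>h\<close>, since the
  retraction of the body sends the point at height \<open>t\<close> over \<open>x\<close> to \<open>h x\<close> (\<open>h_mid_fst\<close>). Transporting
  exactness gives a five-term exact sequence
  \<open>H_p(X) \<rightarrow> H_p(Y) \<rightarrow> H_p(C, Apex) \<rightarrow> H_(p-1)(X) \<rightarrow> H_(p-1)(Y)\<close>, and taking the cokernel of the first
  map and the kernel of the last makes it short exact.

  The topological work is in the deformations. All three follow one formula, the motion
  of cylinder points towards a fixed height. Its continuity is a statement about the
  product of \<open>[0,1]\<close> with the quotient \<open>C\<close>, whose open sets can be recognised on \<open>Y\<close> and on the cylinder
  because \<open>[0,1]\<close> is locally compact (\<open>openin_prod_mapping_cone\<close>).

  Naturality comes from the fact that the map of cones induced by a commutative square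
  preserves body, cap and collar, so that it acts on every group and map used above.
\<close>

section \<open>Exact sequences of groups\<close>

lemma iso_imp_mon: "f \<in> iso A B \<Longrightarrow> f \<in> mon A B"
  by (simp add: iso_iff_mon_epi)

lemma iso_imp_image: "f \<in> iso A B \<Longrightarrow> f ` carrier A = carrier B"
  by (simp add: iso_def bij_betw_def)

lemma iso_inv_into_comp:
  assumes "f \<in> iso A D" "g \<in> iso B D" "group A" "group B"
  shows "(\<lambda>x. inv_into (carrier B) g (f x)) \<in> iso A B"
  using iso_set_trans[OF assms(1) group.iso_set_sym[OF assms(4,2)]] by (simp add: o_def)

lemma exact_seq_image_eq_kernel:
  "exact_seq ([G3, G2, G1], [g2, g1]) \<Longrightarrow> g1 ` carrier G1 = kernel G2 G3 g2"
  by simp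

text \<open>
  Only the middle map of the ladder has to be bijective: surjectivity on the left suffices for the images to
  correspond, injectivity on the right for the kernels.
\<close>
lemma exact_at_transport:
  assumes exact: "f ` carrier A = kernel B C g"
    and \<alpha>: "\<alpha> ` carrier A = carrier A'" and \<beta>: "\<beta> \<in> iso B B'"
    and \<gamma>: "\<gamma> \<in> mon C C'" and g: "g \<in> hom B C" and grp: "group C" "group C'"
    and f': "\<And>a. a \<in> carrier A \<Longrightarrow> f' (\<alpha> a) = \<beta> (f a)"
    and g': "\<And>b. b \<in> carrier B \<Longrightarrow> g' (\<beta> b) = \<gamma> (g b)"
  shows "f' ` carrier A' = kernel B' C' g'"
proof -
  have surj: "\<beta> ` carrier B = carrier B'"
    using \<beta> by (simp add: iso_def bij_betw_def)
  have one: "\<gamma> (g b) = \<one>\<^bsub>C'\<^esub> \<longleftrightarrow> g b = \<one>\<^bsub>C\<^esub>" if "b \<in> carrier B" for b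
  proof -
    have "g b \<in> carrier C" using g that by (rule hom_in_carrier)
    then show ?thesis
      using \<gamma> grp hom_one[of \<gamma> C C'] unfolding mon_iff_hom_one[OF grp] by metis
  qed
  have "kernel B' C' g' = \<beta> ` kernel B C g"
  proof (intro equalityI subsetI)
    fix b' assume "b' \<in> kernel B' C' g'"
    moreover from this obtain b where "b \<in> carrier B" "b' = \<beta> b"
      using surj by (auto simp: kernel_def)
    ultimately show "b' \<in> \<beta> ` kernel B C g"
      using g' one by (simp add: kernel_def)
  next
    fix b' assume "b' \<in> \<beta> ` kernel B C g"
    then obtain b where "b \<in> carrier B" "g b = \<one>\<^bsub>C\<^esub>" "b' = \<beta> b"
      by (auto simp: kernel_def)
    moreover from this have "\<gamma> (g b) = \<one>\<^bsub>C'\<^esub>"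
      using one by blast
    ultimately show "b' \<in> kernel B' C' g'"
      using g' surj unfolding kernel_def by (metis (mono_tags, lifting) image_eqI mem_Collect_eq)
  qed
  moreover have "f' ` carrier A' = \<beta> ` f ` carrier A"
    using f' by (simp add: image_image flip: \<alpha>)
  ultimately show ?thesis by (simp add: exact)
qed

lemma (in group_hom) image_kernel_coset:
  assumes "x \<in> carrier G"
  shows "h ` (kernel G H h #> x) = {h x}"
proof -
  have "x \<in> kernel G H h #> x"
    using assms subgroup_kernel by (rule G.rcos_self)
  moreover have "h z = h x" if z: "z \<in> kernel G H h #> x" for z
  proof -
    obtain k where "k \<in> kernel G H h" "z = k \<otimes> x"
      using z unfolding r_coset_def by blast
    then show ?thesis using assms by (simp add: kernel_def)
  qed
  ultimately show ?thesis by blast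
qed

text \<open>
  By exactness at \<open>B\<close> the left-hand quotient is by the kernel of \<open>g\<close>, so the first isomorphism theorem
  embeds it in \<open>P\<close>; by exactness at \<open>A'\<close> the right-hand group is the range of \<open>d\<close>.
\<close>
lemma short_exact_of_five_term:
  assumes grp: "group A" "group B" "group P" "group A'" "group B'"
    and hom: "f \<in> hom A B" "g \<in> hom B P" "d \<in> hom P A'" "f' \<in> hom A' B'"
    and exact: "f ` carrier A = kernel B P g" "g ` carrier B = kernel P A' d"
      "d ` carrier P = kernel A' B' f'"
  shows "is_short_exact (B Mod (f ` carrier A)) P (subgroup_generated A' (kernel A' B' f'))
           (\<lambda>S. the_elem (g ` S)) d"
proof -
  interpret g: group_hom B P g
    using grp hom by (simp add: group_hom_def group_hom_axioms_def)
  interpret f': group_hom A' B' f'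
    using grp hom by (simp add: group_hom_def group_hom_axioms_def)
  let ?K = "kernel A' B' f'"
  have carrier_K: "carrier (subgroup_generated A' ?K) = ?K"
    by (simp add: f'.subgroup_kernel subgroup.carrier_subgroup_generated_subgroup)
  have 1: "(\<lambda>S. the_elem (g ` S)) \<in> mon (B Mod kernel B P g) P"
    using g.FactGroup_hom g.FactGroup_inj_on by (simp add: mon_def)
  have "d \<in> hom P (subgroup_generated A' ?K)"
  proof (rule homI)
    show "d x \<in> carrier (subgroup_generated A' ?K)" if "x \<in> carrier P" for x
      using that exact(3) carrier_K by blast
    show "d (x \<otimes>\<^bsub>P\<^esub> y) = d x \<otimes>\<^bsub>subgroup_generated A' ?K\<^esub> d y"
      if "x \<in> carrier P" "y \<in> carrier P" for x y
      using that hom(3) by (simp add: hom_mult)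
  qed
  then have 2: "d \<in> epi P (subgroup_generated A' ?K)"
    using exact(3) carrier_K by (simp add: epi_def)
  have 3: "(\<lambda>S. the_elem (g ` S)) ` carrier (B Mod kernel B P g) = g ` carrier B"
    by (auto simp: FactGroup_def RCOSETS_def image_iff g.image_kernel_coset)
  have 4: "kernel P (subgroup_generated A' ?K) d = kernel P A' d"
    by (simp add: kernel_def)
  show ?thesis
    unfolding is_short_exact_def exact(1)
  proof (intro conjI)
    show "group (B Mod kernel B P g)"
      by (rule normal.factorgroup_is_group[OF g.normal_kernel])
    show "group (subgroup_generated A' ?K)"
      by (rule f'.G.group_subgroup_generated)
  qed (use 1 2 grp in \<open>simp_all only: 3 4 exact(2)\<close>)
qed

lemma iso_of_short_exact:
  assumes "is_short_exact A B C \<alpha> \<beta>" "carrier C = {\<one>\<^bsub>C\<^esub>}"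
  shows "\<alpha> \<in> iso A B"
proof -
  have "\<beta> x = \<one>\<^bsub>C\<^esub>" if "x \<in> carrier B" for x
    using assms that unfolding is_short_exact_def epi_def by blast
  then have "kernel B C \<beta> = carrier B"
    by (auto simp: kernel_def)
  then show ?thesis
    using assms(1) unfolding is_short_exact_def mon_def iso_def bij_betw_def by simp
qed

section \<open>The topology of a mapping cone\<close>

lemma openin_tube:
  assumes "openin (prod_topology K Z) S" "compactin K J"
  shows "openin Z {z \<in> topspace Z. J \<times> {z} \<subseteq> S}"
proof (subst openin_subopen, intro ballI)
  fix z assume "z \<in> {z \<in> topspace Z. J \<times> {z} \<subseteq> S}"
  then have z: "z \<in> topspace Z" "J \<times> {z} \<subseteq> S" by auto
  obtain U V where UV: "openin K U" "openin Z V" "J \<subseteq> U" "z \<in> V" "U \<times> V \<subseteq> S"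
    using tube_lemma_left[OF assms z] by (elim exE conjE)
  have "V \<subseteq> {z \<in> topspace Z. J \<times> {z} \<subseteq> S}"
    using openin_subset[OF UV(2)] UV(3,5) by auto
  then show "\<exists>T. openin Z T \<and> z \<in> T \<and> T \<subseteq> {z \<in> topspace Z. J \<times> {z} \<subseteq> S}"
    using UV(2,4) by (intro exI[of _ V] conjI)
qed

lemma openin_slice:
  assumes "openin (prod_topology K Z) S" "z \<in> topspace Z"
  shows "openin K {u \<in> topspace K. (u, z) \<in> S}"
proof -
  have "continuous_map K (prod_topology K Z) (\<lambda>u. (u, z))"
    using assms(2) by (simp add: continuous_map_paired)
  then show ?thesis using assms(1) by (rule openin_continuous_map_preimage)
qed

lemma cone_glue_in_cone_points:
  assumes "h \<in> topspace X \<rightarrow> topspace Y" "q \<in> topspace X \<times> {0..1}"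
  shows "cone_glue h q \<in> cone_points X Y"
proof -
  obtain x t where q: "q = (x, t)" "x \<in> topspace X" "0 \<le> t" "t \<le> 1"
    using assms(2) by auto
  moreover have "h x \<in> topspace Y" using assms(1) q(2) by blast
  ultimately show ?thesis by (auto simp: cone_points_def cone_glue_def)
qed

lemma topspace_mapping_cone:
  assumes "h \<in> topspace X \<rightarrow> topspace Y"
  shows "topspace (mapping_cone X Y h) = cone_points X Y"
proof
  show "topspace (mapping_cone X Y h) \<subseteq> cone_points X Y"
    using openin_mapping_cone[THEN iffD1, OF openin_topspace] by (rule conjunct1)
  have "{y \<in> topspace Y. (Base y :: ('a, 'b) cone_pt) \<in> cone_points X Y} = topspace Y"
    by (auto simp: cone_points_def)
  moreover have "{p \<in> topspace X \<times> {0..1}. cone_glue h p \<in> cone_points X Y}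
      = topspace (prod_topology X (top_of_set {0..1}))"
    using cone_glue_in_cone_points[OF assms] by auto
  ultimately have "openin (mapping_cone X Y h) (cone_points X Y)"
    unfolding openin_mapping_cone by (simp only: openin_topspace simp_thms order_refl)
  then show "cone_points X Y \<subseteq> topspace (mapping_cone X Y h)" by (rule openin_subset)
qed

text \<open>
  This is Whitehead's theorem, that multiplication with a locally compact Hausdorff space preserves quotient
  maps, for the quotient map from the disjoint union of \<open>Y\<close>, the cylinder and the apex to the cone.
  Around a point of \<open>N\<close>, the slice of \<open>N\<close> in the direction of \<open>K\<close> contains a
  compact neighbourhood \<open>J\<close>; by the tube lemma, applied on each piece separately, the cone points \<open>d\<close> with
  \<open>J \<times> {d} \<subseteq> N\<close> form an open set. The apex is a piece of its own
  because the cylinder does not reach it when \<open>X\<close> is empty.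
\<close>
lemma openin_prod_mapping_cone:
  fixes N :: "('k \<times> ('x, 'y) cone_pt) set"
  assumes K: "locally_compact_space K" "Hausdorff_space K"
    and N: "N \<subseteq> topspace K \<times> cone_points X Y"
    and base: "openin (prod_topology K Y) {(s, y). s \<in> topspace K \<and> y \<in> topspace Y \<and> (s, Base y) \<in> N}"
    and glue: "openin (prod_topology K (prod_topology X (top_of_set {0..1})))
      {(s, q). s \<in> topspace K \<and> q \<in> topspace X \<times> {0..1} \<and> (s, cone_glue h q) \<in> N}"
    and apex: "openin K {s \<in> topspace K. (s, Apex) \<in> N}"
  shows "openin (prod_topology K (mapping_cone X Y h)) N"
proof (subst openin_subopen, intro ballI)
  let ?C = "mapping_cone X Y h" and ?Z = "prod_topology X (top_of_set {0..1::real})"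
  let ?NY = "{(s, y). s \<in> topspace K \<and> y \<in> topspace Y \<and> (s, Base y) \<in> N}"
  let ?NZ = "{(s, q). s \<in> topspace K \<and> q \<in> topspace X \<times> {0..1} \<and> (s, cone_glue h q) \<in> N}"
  fix p assume p: "p \<in> N"
  obtain s c where sc: "p = (s, c)" "s \<in> topspace K" "c \<in> cone_points X Y" "(s, c) \<in> N"
    using p N by (cases p) auto
  have "openin K {u \<in> topspace K. (u, c) \<in> N}"
  proof (cases c)
    case (Base y)
    then have y: "y \<in> topspace Y" using sc(3) by (auto simp: cone_points_def)
    then show ?thesis using openin_slice[OF base y] Base by (simp cong: conj_cong)
  next
    case (Mid x t)
    then have q: "(x, t) \<in> topspace ?Z" and "cone_glue h (x, t) = c"
      using sc(3) by (auto simp: cone_points_def cone_glue_def)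
    then show ?thesis using openin_slice[OF glue q] by (simp cong: conj_cong)
  next
    case Apex
    then show ?thesis using apex by simp
  qed
  moreover have "s \<in> {u \<in> topspace K. (u, c) \<in> N}" using sc by simp
  moreover have "neighbourhood_base_of (\<lambda>J. compactin K J \<and> closedin K J) K"
    using K(1) locally_compact_space_neighbourhood_base_closedin[OF disjI1[OF K(2)]] by simp
  ultimately obtain U J where UJ: "openin K U" "compactin K J" "s \<in> U" "U \<subseteq> J"
      "J \<subseteq> {u \<in> topspace K. (u, c) \<in> N}"
    unfolding neighbourhood_base_of by meson
  let ?M = "{d \<in> cone_points X Y. J \<times> {d} \<subseteq> N}"
  have J: "J \<subseteq> topspace K" using UJ(5) by blast
  have cp: "d \<in> cone_points X Y" if "(u, d) \<in> N" for u d
    using that N by blast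
  have "openin ?C ?M"
    unfolding openin_mapping_cone
  proof (intro conjI)
    show "openin Y {y \<in> topspace Y. Base y \<in> ?M}"
    proof -
      have "{y \<in> topspace Y. Base y \<in> ?M} = {y \<in> topspace Y. J \<times> {y} \<subseteq> ?NY}"
        using J by (auto simp: cone_points_def)
      then show ?thesis using openin_tube[OF base UJ(2)] by simp
    qed
    show "openin ?Z {q \<in> topspace X \<times> {0..1}. cone_glue h q \<in> ?M}"
    proof -
      have "cone_glue h q \<in> cone_points X Y" if "J \<times> {q} \<subseteq> ?NZ" for q
        using that UJ(3,4) cp by blast
      then have "{q \<in> topspace X \<times> {0..1}. cone_glue h q \<in> ?M} = {q \<in> topspace ?Z. J \<times> {q} \<subseteq> ?NZ}"
        using J by auto
      then show ?thesis using openin_tube[OF glue UJ(2)] by simp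
    qed
  qed blast
  then have "openin (prod_topology K ?C) (U \<times> ?M)"
    using UJ(1) by (simp add: openin_prod_Times_iff)
  moreover have "p \<in> U \<times> ?M" using sc UJ by blast
  moreover have "U \<times> ?M \<subseteq> N" using UJ(4) by blast
  ultimately show "\<exists>T. openin (prod_topology K ?C) T \<and> p \<in> T \<and> T \<subseteq> N" by blast
qed

locale cone_map =
  fixes X :: "'x topology" and Y :: "'y topology" and h :: "'x \<Rightarrow> 'y"
  assumes continuous_h: "continuous_map X Y h"
begin

abbreviation C :: "('x, 'y) cone_pt topology" where "C \<equiv> mapping_cone X Y h"

text \<open>
  \<open>Base\<close> embeds \<open>Y\<close> in the cone, so the cap and the body are the complements of the two ends of the cylinder.
\<close>
definition cap :: "('x, 'y) cone_pt set" where "cap = topspace C - range Base"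
definition body :: "('x, 'y) cone_pt set" where "body = topspace C - {Apex}"
definition collar :: "('x, 'y) cone_pt set" where "collar = body \<inter> cap"

lemma h_in: "h \<in> topspace X \<rightarrow> topspace Y"
  using continuous_h by (simp add: continuous_map_def)

lemma h_in_topspace: "x \<in> topspace X \<Longrightarrow> h x \<in> topspace Y"
  using h_in by blast

lemma topspace_C: "topspace C = cone_points X Y"
  by (rule topspace_mapping_cone[OF h_in])

lemma cap_eq: "cap = {Mid x t |x t. x \<in> topspace X \<and> 0 < t \<and> t < 1} \<union> {Apex}"
  unfolding cap_def topspace_C cone_points_def by auto

lemma body_eq: "body = Base ` topspace Y \<union> {Mid x t |x t. x \<in> topspace X \<and> 0 < t \<and> t < 1}"
  unfolding body_def topspace_C cone_points_def by auto

lemma collar_eq: "collar = {Mid x t |x t. x \<in> topspace X \<and> 0 < t \<and> t < 1}"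
  unfolding collar_def cap_eq body_eq by auto

lemma openin_C:
  "openin C U \<longleftrightarrow> U \<subseteq> topspace C \<and> openin Y {y \<in> topspace Y. Base y \<in> U} \<and>
    openin (prod_topology X (top_of_set {0..1})) {q \<in> topspace X \<times> {0..1}. cone_glue h q \<in> U}"
  by (simp add: openin_mapping_cone topspace_C)

lemma openin_cylinder:
  assumes "openin X O'" "open S"
  shows "openin (prod_topology X (top_of_set {0..1::real})) (O' \<times> ({0..1} \<inter> S))"
  using assms by (simp add: openin_prod_Times_iff openin_open_Int)

lemma openin_cap: "openin C cap"
  unfolding openin_C
proof (intro conjI)
  have "{y \<in> topspace Y. Base y \<in> cap} = {}" by (auto simp: cap_eq)
  then show "openin Y {y \<in> topspace Y. Base y \<in> cap}" by (simp only: openin_empty)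
  have "{q \<in> topspace X \<times> {0..1}. cone_glue h q \<in> cap} = topspace X \<times> ({0..1} \<inter> {0<..})"
    by (auto simp: cap_eq cone_glue_def split: if_splits)
  then show "openin (prod_topology X (top_of_set {0..1})) {q \<in> topspace X \<times> {0..1}. cone_glue h q \<in> cap}"
    by (simp only: openin_cylinder openin_topspace open_greaterThan)
qed (simp add: cap_def)

lemma openin_body: "openin C body"
  unfolding openin_C
proof (intro conjI)
  have "{y \<in> topspace Y. Base y \<in> body} = topspace Y" by (auto simp: body_eq)
  then show "openin Y {y \<in> topspace Y. Base y \<in> body}" by (simp only: openin_topspace)
  have "{q \<in> topspace X \<times> {0..1}. cone_glue h q \<in> body} = topspace X \<times> ({0..1} \<inter> {..<1})"
    using h_in_topspace by (auto simp: body_eq cone_glue_def split: if_splits)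
  then show "openin (prod_topology X (top_of_set {0..1})) {q \<in> topspace X \<times> {0..1}. cone_glue h q \<in> body}"
    by (simp only: openin_cylinder openin_topspace open_lessThan)
qed (simp add: body_def)

lemma openin_collar: "openin C collar"
  unfolding collar_def by (intro openin_Int openin_body openin_cap)

lemma topspace_cap [simp]: "topspace (subtopology C cap) = cap"
  and topspace_body [simp]: "topspace (subtopology C body) = body"
  and topspace_collar [simp]: "topspace (subtopology C collar) = collar"
  using openin_subset[OF openin_cap] openin_subset[OF openin_body] openin_subset[OF openin_collar]
  by (simp_all add: topspace_subtopology Int_absorb1)

lemma continuous_Base: "continuous_map Y C Base"
  unfolding continuous_map_def
proof (intro conjI allI impI)
  show "Base \<in> topspace Y \<rightarrow> topspace C" by (auto simp: topspace_C cone_points_def)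
qed (simp add: openin_C)

lemma continuous_cone_glue: "continuous_map (prod_topology X (top_of_set {0..1})) C (cone_glue h)"
  unfolding continuous_map_def
proof (intro conjI allI impI)
  show "cone_glue h \<in> topspace (prod_topology X (top_of_set {0..1})) \<rightarrow> topspace C"
    using cone_glue_in_cone_points[OF h_in] by (simp add: topspace_C)
qed (simp add: openin_C)

text \<open>
  The straight motion of cylinder points between height \<open>c\<close>, at time \<open>0\<close>, and their own
  height, at time \<open>1\<close>. The values \<open>c = 0\<close>, \<open>c = 1\<close> and \<open>c = 1/2\<close> deform the body onto \<open>Y\<close>,
  the cap to the apex, and the collar onto its middle level.
\<close>
definition slide :: "real \<Rightarrow> real \<times> ('x, 'y) cone_pt \<Rightarrow> ('x, 'y) cone_pt" where
  "slide c = (\<lambda>(s, p). case p of Mid x t \<Rightarrow> cone_glue h (x, (1 - s) * c + s * t) | _ \<Rightarrow> p)"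

lemma slide_simps [simp]:
  "slide c (s, Base y) = Base y" "slide c (s, Apex) = Apex"
  "slide c (s, Mid x t) = cone_glue h (x, (1 - s) * c + s * t)"
  by (simp_all add: slide_def)

lemma convex_unit:
  assumes "s \<in> {0..1}" "c \<in> {0..1}" "t \<in> {0..1::real}"
  shows "(1 - s) * c + s * t \<in> {0..1}"
  using convexD[OF convex_real_interval(5)[of 0 1], of c t "1 - s" s] assms by simp

lemma slide_cone_glue:
  assumes "cone_glue h (x, t) \<in> S" "\<And>y. Base y \<in> S \<Longrightarrow> c = 0" "Apex \<in> S \<Longrightarrow> c = 1"
  shows "slide c (s, cone_glue h (x, t)) = cone_glue h (x, (1 - s) * c + s * t)"
proof -
  consider "t = 0" "c = 0" | "t = 1" "c = 1" | "t \<noteq> 0" "t \<noteq> 1"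
    using assms by (auto simp: cone_glue_def split: if_splits)
  then show ?thesis by cases (auto simp: cone_glue_def)
qed

text \<open>
  Since \<open>slide\<close> keeps the points of \<open>Y\<close> fixed, it matches the motion of the cylinder at height \<open>0\<close> only if
  \<open>c = 0\<close>; likewise it matches at the apex only if \<open>c = 1\<close>. Hence the conditions linking \<open>S\<close> and \<open>c\<close>.
\<close>
lemma continuous_slide:
  assumes S: "openin C S" and c: "c \<in> {0..1}"
    and Base: "\<And>y. Base y \<in> S \<Longrightarrow> c = 0" and Apex: "Apex \<in> S \<Longrightarrow> c = 1"
    and closed: "\<And>s p. s \<in> {0..1} \<Longrightarrow> p \<in> S \<Longrightarrow> slide c (s, p) \<in> S"
  shows "continuous_map (prod_topology (top_of_set {0..1}) (subtopology C S)) (subtopology C S) (slide c)"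
proof -
  let ?I = "top_of_set {0..1::real}"
  let ?Z = "prod_topology X ?I"
  let ?m = "\<lambda>p. (fst (snd p), (1 - fst p) * c + fst p * snd (snd p))"
  have SC: "S \<subseteq> topspace C" using S by (rule openin_subset)
  then have top_S: "topspace (subtopology C S) = S" by (simp add: Int_absorb1)
  have "continuous_map (prod_topology ?I ?Z) X (fst \<circ> snd)"
    by (intro continuous_map_compose[OF continuous_map_snd continuous_map_fst])
  moreover have "continuous_map (prod_topology ?I ?Z) ?I (\<lambda>p. (1 - fst p) * c + fst p * snd (snd p))"
  proof -
    have 1: "continuous_map (prod_topology ?I ?Z) euclideanreal fst"
      by (rule continuous_map_into_fulltopology[OF continuous_map_fst])
    have "continuous_map (prod_topology ?I ?Z) ?I (snd \<circ> snd)"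
      by (intro continuous_map_compose[OF continuous_map_snd continuous_map_snd])
    then have 2: "continuous_map (prod_topology ?I ?Z) euclideanreal (\<lambda>p. snd (snd p))"
      by (simp add: continuous_map_in_subtopology o_def)
    show ?thesis
      unfolding continuous_map_in_subtopology
    proof
      show "continuous_map (prod_topology ?I ?Z) euclideanreal (\<lambda>p. (1 - fst p) * c + fst p * snd (snd p))"
        by (intro continuous_map_add continuous_map_diff continuous_map_real_mult continuous_map_const[THEN iffD2] 1 2) auto
      show "(\<lambda>p. (1 - fst p) * c + fst p * snd (snd p)) \<in> topspace (prod_topology ?I ?Z) \<rightarrow> {0..1}"
        using convex_unit[OF _ c] by auto
    qed
  qed
  ultimately have move: "continuous_map (prod_topology ?I ?Z) ?Z ?m"
    by (simp add: continuous_map_pairwise o_def)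
  have "openin (prod_topology ?I (subtopology C S)) {p \<in> {0..1} \<times> S. slide c p \<in> U}"
    if U: "openin C U" for U
  proof -
    let ?N = "{p \<in> {0..1} \<times> S. slide c p \<in> U}"
    have "openin (prod_topology ?I C) ?N"
    proof (rule openin_prod_mapping_cone)
      show "locally_compact_space ?I"
        by (simp add: compact_imp_locally_compact_space compact_space_subtopology)
      show "Hausdorff_space ?I" by (simp add: Hausdorff_space_subtopology)
      show "?N \<subseteq> topspace ?I \<times> cone_points X Y" using SC by (auto simp: topspace_C)
      have "openin (prod_topology ?I Y)
          (topspace ?I \<times> ({y \<in> topspace Y. Base y \<in> U} \<inter> {y \<in> topspace Y. Base y \<in> S}))"
        using U(1) S unfolding openin_prod_Times_iff openin_C by (intro disjI2 conjI openin_topspace openin_Int) auto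
      moreover have "{(s, y). s \<in> topspace ?I \<and> y \<in> topspace Y \<and> (s, Base y) \<in> ?N} =
         topspace ?I \<times> ({y \<in> topspace Y. Base y \<in> U} \<inter> {y \<in> topspace Y. Base y \<in> S})" by auto
      ultimately show "openin (prod_topology ?I Y) {(s, y). s \<in> topspace ?I \<and> y \<in> topspace Y \<and> (s, Base y) \<in> ?N}"
        by (simp only:)
      show "openin ?I {s \<in> topspace ?I. (s, Apex) \<in> ?N}"
      proof (cases "Apex \<in> S \<inter> U")
        case True
        then have "{s \<in> topspace ?I. (s, Apex) \<in> ?N} = topspace ?I" by auto
        then show ?thesis by (simp only: openin_topspace)
      next
        case False
        then have "{s \<in> topspace ?I. (s, Apex) \<in> ?N} = {}" by auto
        then show ?thesis by (simp only: openin_empty)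
      qed
      let ?L = "{(s, q). s \<in> topspace ?I \<and> q \<in> topspace X \<times> {0..1} \<and> (s, cone_glue h q) \<in> ?N}"
      let ?S = "{q \<in> topspace X \<times> {0..1}. cone_glue h q \<in> S}"
      have "openin ?Z ?S"
        using S by (simp add: openin_C)
      then have "openin (prod_topology ?I ?Z) (topspace ?I \<times> ?S)"
        unfolding openin_prod_Times_iff by (intro disjI2 conjI openin_topspace)
      moreover have "openin (prod_topology ?I ?Z) {p \<in> topspace (prod_topology ?I ?Z). (cone_glue h \<circ> ?m) p \<in> U}"
        using continuous_map_compose[OF move continuous_cone_glue] U(1)
        by (rule openin_continuous_map_preimage)
      moreover have "?L = (topspace ?I \<times> ?S) \<inter>
          {p \<in> topspace (prod_topology ?I ?Z). (cone_glue h \<circ> ?m) p \<in> U}"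
        using slide_cone_glue[OF _ Base Apex] by auto
      ultimately show "openin (prod_topology ?I ?Z) ?L"
        by (simp only: openin_Int)
    qed
    then have "openin (subtopology (prod_topology ?I C) (topspace ?I \<times> S)) ?N"
      unfolding openin_subtopology[of "prod_topology ?I C"] by (intro exI[of _ ?N]) auto
    then show ?thesis
      by (simp only: prod_topology_subtopology(2))
  qed
  moreover have "slide c \<in> {0..1} \<times> S \<rightarrow> S"
    using closed by auto
  ultimately show ?thesis
    unfolding continuous_map_def openin_open_subtopology[OF S] by (simp add: Int_absorb1[OF SC])
qed

section \<open>Body, cap and collar up to homotopy\<close>

lemma cone_glue_in_cap: "x \<in> topspace X \<Longrightarrow> 0 < t \<Longrightarrow> t \<le> 1 \<Longrightarrow> cone_glue h (x, t) \<in> cap"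
  and cone_glue_in_body: "x \<in> topspace X \<Longrightarrow> 0 \<le> t \<Longrightarrow> t < 1 \<Longrightarrow> cone_glue h (x, t) \<in> body"
  using h_in_topspace by (auto simp: cone_glue_def cap_eq body_eq)

lemma slide_1: "p \<in> topspace C \<Longrightarrow> slide c (1, p) = p"
  by (auto simp: topspace_C cone_points_def cone_glue_def)

lemma collar_cases:
  assumes "p \<in> collar"
  obtains x t where "p = Mid x t" "x \<in> topspace X" "0 < t" "t < 1"
  using assms by (auto simp: collar_eq)

lemma cap_cases:
  assumes "p \<in> cap"
  obtains x t where "p = Mid x t" "x \<in> topspace X" "0 < t" "t < 1" | "p = Apex"
  using assms by (auto simp: cap_eq)

lemma body_cases:
  assumes "p \<in> body"
  obtains x t where "p = Mid x t" "x \<in> topspace X" "0 < t" "t < 1"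
    | y where "p = Base y" "y \<in> topspace Y"
  using assms by (auto simp: body_eq)

lemma slide_in_cap:
  assumes "s \<in> {0..1}" "p \<in> cap" "0 < c" "c \<le> 1"
  shows "slide c (s, p) \<in> cap"
  using assms(2)
proof (cases rule: cap_cases)
  case (1 x t)
  have "0 < (1 - s) * c + s * t"
    using 1 assms by (cases "s = 1") (auto intro!: add_pos_nonneg)
  moreover have "(1 - s) * c + s * t \<le> 1"
    using 1 assms convex_unit[of s c t] by simp
  ultimately show ?thesis using 1 cone_glue_in_cap by simp
qed (simp add: cap_eq)

lemma slide_in_body:
  assumes "s \<in> {0..1}" "p \<in> body" "0 \<le> c" "c < 1"
  shows "slide c (s, p) \<in> body"
  using assms(2)
proof (cases rule: body_cases)
  case (1 x t)
  have "0 < (1 - s) * (1 - c) + s * (1 - t)"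
    using 1 assms by (cases "s = 1") (auto intro!: add_pos_nonneg)
  then have "(1 - s) * c + s * t < 1"
    by (simp add: algebra_simps)
  moreover have "0 \<le> (1 - s) * c + s * t"
    using 1 assms convex_unit[of s c t] by simp
  ultimately show ?thesis using 1 cone_glue_in_body by simp
qed (simp add: body_eq)

lemma slide_homotopy:
  assumes "openin C S" "c \<in> {0..1}"
    "\<And>y. Base y \<in> S \<Longrightarrow> c = 0" "Apex \<in> S \<Longrightarrow> c = 1"
    "\<And>s p. s \<in> {0..1} \<Longrightarrow> p \<in> S \<Longrightarrow> slide c (s, p) \<in> S"
    and g: "\<And>p. p \<in> S \<Longrightarrow> slide c (0, p) = g p"
  shows "homotopic_with (\<lambda>_. True) (subtopology C S) (subtopology C S) g id"
  using continuous_slide[OF assms(1-5)] slide_1[where c = c] g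
  by (subst homotopic_with) (auto intro!: exI[of _ "slide c"])

definition retract :: "('x, 'y) cone_pt \<Rightarrow> 'y" where
  "retract p = (case p of Base y \<Rightarrow> y | Mid x t \<Rightarrow> h x | Apex \<Rightarrow> undefined)"

lemma retract_simps [simp]: "retract (Base y) = y" "retract (Mid x t) = h x"
  by (simp_all add: retract_def)

lemma continuous_Base_body: "continuous_map Y (subtopology C body) Base"
  using continuous_Base by (auto simp: continuous_map_in_subtopology body_eq)

lemma continuous_retract: "continuous_map (subtopology C body) Y retract"
  unfolding continuous_map_def openin_open_subtopology[OF openin_body] topspace_body
proof (intro conjI allI impI)
  show "retract \<in> body \<rightarrow> topspace Y"
    using h_in_topspace by (auto simp: body_eq)
  fix U assume U: "openin Y U"
  let ?P = "{p \<in> body. retract p \<in> U}"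
  show "openin C ?P"
    unfolding openin_C
  proof (intro conjI)
    have "{y \<in> topspace Y. Base y \<in> ?P} = U"
      using openin_subset[OF U] by (auto simp: body_eq)
    then show "openin Y {y \<in> topspace Y. Base y \<in> ?P}" using U by (simp only:)
    have "{q \<in> topspace X \<times> {0..1}. cone_glue h q \<in> ?P} =
        {x \<in> topspace X. h x \<in> U} \<times> ({0..1} \<inter> {..<1})"
      using h_in_topspace by (auto simp: body_eq cone_glue_def split: if_splits)
    then show "openin (prod_topology X (top_of_set {0..1})) {q \<in> topspace X \<times> {0..1}. cone_glue h q \<in> ?P}"
      using openin_cylinder[OF openin_continuous_map_preimage[OF continuous_h U] open_lessThan]
      by (simp only:)
  qed (use openin_subset[OF openin_body] in blast)
qed blast

lemma retract_group_isomorphisms: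
  "group_isomorphisms (homology_group p (subtopology C body)) (homology_group p Y)
    (hom_induced p (subtopology C body) {} Y {} retract) (hom_induced p Y {} (subtopology C body) {} Base)"
proof (rule homotopy_equivalence_relative_homology_group_isomorphisms)
  have "homotopic_with (\<lambda>_. True) (subtopology C body) (subtopology C body) (Base \<circ> retract) id"
  proof (rule slide_homotopy[OF openin_body, of 0])
    show "slide 0 (0, p) = (Base \<circ> retract) p" if "p \<in> body" for p
      using that by (cases rule: body_cases) (auto simp: cone_glue_def)
  qed (use slide_in_body in \<open>auto simp: body_def\<close>)
  then show "homotopic_with (\<lambda>h. h \<in> {} \<rightarrow> {}) (subtopology C body) (subtopology C body) (Base \<circ> retract) id"
    by simp
  show "homotopic_with (\<lambda>h. h \<in> {} \<rightarrow> {}) Y Y (retract \<circ> Base) id"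
    by (simp add: o_def flip: id_def)
qed (simp_all add: continuous_retract continuous_Base_body)

lemma continuous_mid_fst: "continuous_map (subtopology C collar) X mid_fst"
  unfolding continuous_map_def openin_open_subtopology[OF openin_collar] topspace_collar
proof (intro conjI allI impI)
  show "mid_fst \<in> collar \<rightarrow> topspace X"
    by (auto simp: collar_eq)
  fix U assume U: "openin X U"
  let ?P = "{p \<in> collar. mid_fst p \<in> U}"
  show "openin C ?P"
    unfolding openin_C
  proof (intro conjI)
    have "{y \<in> topspace Y. Base y \<in> ?P} = {}"
      by (auto simp: collar_eq)
    then show "openin Y {y \<in> topspace Y. Base y \<in> ?P}" by (simp only: openin_empty)
    have "{q \<in> topspace X \<times> {0..1}. cone_glue h q \<in> ?P} = U \<times> ({0..1} \<inter> {0<..<1})"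
      using openin_subset[OF U] by (auto simp: collar_eq cone_glue_def split: if_splits)
    then show "openin (prod_topology X (top_of_set {0..1})) {q \<in> topspace X \<times> {0..1}. cone_glue h q \<in> ?P}"
      using openin_cylinder[OF U open_greaterThanLessThan] by (simp only:)
  qed (use openin_subset[OF openin_collar] in blast)
qed blast

lemma mid_fst_iso:
  "hom_induced p (subtopology C collar) {} X {} mid_fst
    \<in> iso (homology_group p (subtopology C collar)) (homology_group p X)"
proof (rule homotopy_equivalence_homology_group_isomorphism)
  let ?g = "\<lambda>x. cone_glue h (x, 1/2)"
  have "continuous_map X (prod_topology X (top_of_set {0..1::real})) (\<lambda>x. (x, 1/2))"
    by (simp add: continuous_map_paired)
  from continuous_map_compose[OF this continuous_cone_glue]
  show "continuous_map X (subtopology C collar) ?g"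
    by (auto simp: continuous_map_in_subtopology o_def collar_eq cone_glue_def intro!: exI[of _ "1/2"])
  show "homotopic_with (\<lambda>_. True) (subtopology C collar) (subtopology C collar) (?g \<circ> mid_fst) id"
  proof (rule slide_homotopy[OF openin_collar, of "1/2"])
    show "slide (1/2) (0, p) = (?g \<circ> mid_fst) p" if "p \<in> collar" for p
      using that by (cases rule: collar_cases) auto
  qed (use slide_in_body slide_in_cap in \<open>auto simp: collar_def body_def cap_def\<close>)
  show "homotopic_with (\<lambda>_. True) X X (mid_fst \<circ> ?g) id"
    by (simp add: o_def cone_glue_def flip: id_def)
qed (rule continuous_mid_fst)

lemma Apex_in_cap: "Apex \<in> cap"
  by (simp add: cap_eq)

lemma trivial_homology_cap_Apex:
  "trivial_group (relative_homology_group p (subtopology C cap) {Apex})"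
proof (rule trivial_relative_homology_group_gen)
  let ?A = "subtopology (subtopology C cap) {Apex}"
  have A: "topspace ?A = {Apex}"
    using Apex_in_cap openin_subset[OF openin_cap] by auto
  show "continuous_map (subtopology C cap) ?A (\<lambda>_. Apex)"
    using A by (simp add: continuous_map_const)
  show "homotopic_with (\<lambda>_. True) ?A ?A (\<lambda>_. Apex) id"
    by (rule homotopic_with_equal) (use A in \<open>auto simp: continuous_map_const\<close>)
  show "homotopic_with (\<lambda>_. True) (subtopology C cap) (subtopology C cap) (\<lambda>_. Apex) id"
  proof (rule slide_homotopy[OF openin_cap, of 1])
    show "slide 1 (0, p) = Apex" if "p \<in> cap" for p
      using that by (cases rule: cap_cases) (auto simp: cone_glue_def)
  qed (use slide_in_cap in \<open>auto simp: cap_def\<close>)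
qed

text \<open>
  In the exact sequence of the triple \<open>(C, cap, Apex)\<close> the groups of \<open>(cap, Apex)\<close> vanish.
\<close>
lemma Apex_cap_iso:
  "hom_induced p C {Apex} C cap id
    \<in> iso (relative_homology_group p C {Apex}) (relative_homology_group p C cap)"
proof -
  let ?k = "hom_induced p C {Apex} C cap id"
  let ?A = "\<lambda>p. relative_homology_group p (subtopology C cap) {Apex}"
  have sub: "{Apex} \<subseteq> cap" using Apex_in_cap by simp
  interpret k: group_hom "relative_homology_group p C {Apex}" "relative_homology_group p C cap" ?k
    by (simp add: group_hom_def group_hom_axioms_def hom_induced_hom)
  have "?k ` carrier (relative_homology_group p C {Apex})
      = kernel (relative_homology_group p C cap) (?A (p - 1)) (hom_relboundary p C cap {Apex})"
    by (rule exact_seq_image_eq_kernel[OF homology_exactness_triple_1[OF sub]])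
  also have "\<dots> = carrier (relative_homology_group p C cap)"
    using hom_relboundary[of p C cap "{Apex}"] trivial_homology_cap_Apex[of "p - 1"]
    by (auto simp: kernel_def trivial_group_def)
  finally have surj: "?k ` carrier (relative_homology_group p C {Apex}) = carrier (relative_homology_group p C cap)" .
  have "kernel (relative_homology_group p C {Apex}) (relative_homology_group p C cap) ?k
      = hom_induced p (subtopology C cap) {Apex} C {Apex} id ` carrier (?A p)"
    using exact_seq_image_eq_kernel[OF homology_exactness_triple_3[OF sub]] by (rule sym)
  also have "\<dots> = {\<one>\<^bsub>relative_homology_group p C {Apex}\<^esub>}"
    using trivial_homology_cap_Apex[of p] hom_one[OF hom_induced_hom]
    by (simp add: trivial_group_def)
  finally have "inj_on ?k (carrier (relative_homology_group p C {Apex}))"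
    by (simp add: k.inj_iff_trivial_ker)
  with surj show ?thesis
    by (simp add: iso_def bij_betw_def hom_induced_hom)
qed

text \<open>The excised set is the apex, a closed set inside the open set \<open>cap\<close>.\<close>
lemma excision_iso:
  "hom_induced p (subtopology C body) collar C cap id
    \<in> iso (relative_homology_group p (subtopology C body) collar) (relative_homology_group p C cap)"
proof -
  have "topspace C - body = {Apex}"
    using Apex_in_cap openin_subset[OF openin_cap] by (auto simp: body_def)
  then have "closedin C {Apex}"
    using openin_body openin_subset[OF openin_cap] Apex_in_cap
    by (metis closedin_def double_diff openin_subset closedin_diff closedin_topspace)
  then have "C closure_of {Apex} \<subseteq> C interior_of cap"
    using Apex_in_cap openin_cap by (simp add: closure_of_closedin interior_of_openin)
  from homology_excision_axiom[OF this openin_subset[OF openin_cap], of p]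
  have "hom_induced p (subtopology C body) (cap - {Apex}) C cap id
    \<in> iso (relative_homology_group p (subtopology C body) (cap - {Apex})) (relative_homology_group p C cap)"
    by (simp add: body_def)
  moreover have "cap - {Apex} = collar"
    by (auto simp: cap_eq collar_eq)
  ultimately show ?thesis by simp
qed

section \<open>The exact sequence of a mapping cone\<close>

abbreviation cone_incl :: "int \<Rightarrow> 'y chain set \<Rightarrow> ('x, 'y) cone_pt chain set" where
  "cone_incl p \<equiv> hom_induced p Y {} C {Apex} Base"

text \<open>
  The two mutually inverse identifications of \<open>H_p(C, Apex)\<close> with \<open>H_p(body, collar)\<close>, both through
  \<open>H_p(C, cap)\<close>.
\<close>
definition to_body :: "int \<Rightarrow> ('x, 'y) cone_pt chain set \<Rightarrow> ('x, 'y) cone_pt chain set" where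
  "to_body p z =
     inv_into (carrier (relative_homology_group p (subtopology C body) collar))
       (hom_induced p (subtopology C body) collar C cap id) (hom_induced p C {Apex} C cap id z)"

definition of_body :: "int \<Rightarrow> ('x, 'y) cone_pt chain set \<Rightarrow> ('x, 'y) cone_pt chain set" where
  "of_body p w =
     inv_into (carrier (relative_homology_group p C {Apex}))
       (hom_induced p C {Apex} C cap id) (hom_induced p (subtopology C body) collar C cap id w)"

definition connecting :: "int \<Rightarrow> ('x, 'y) cone_pt chain set \<Rightarrow> 'x chain set" where
  "connecting p z =
     hom_induced (p - 1) (subtopology C collar) {} X {} mid_fst
       (hom_boundary p (subtopology C body) collar (to_body p z))"

lemma collar_subset_body: "collar \<subseteq> body" and collar_subset_cap: "collar \<subseteq> cap"
  by (auto simp: collar_def)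

lemma subtopology_body_collar: "subtopology (subtopology C body) collar = subtopology C collar"
  using collar_subset_body by (simp add: subtopology_subtopology Int_absorb1)

lemma of_body_iso:
  "of_body p \<in> iso (relative_homology_group p (subtopology C body) collar) (relative_homology_group p C {Apex})"
  unfolding of_body_def[abs_def] by (rule iso_inv_into_comp[OF excision_iso Apex_cap_iso]) simp_all

lemma to_body_iso:
  "to_body p \<in> iso (relative_homology_group p C {Apex}) (relative_homology_group p (subtopology C body) collar)"
  unfolding to_body_def[abs_def] by (rule iso_inv_into_comp[OF Apex_cap_iso excision_iso]) simp_all

lemma of_body_eqI:
  assumes "z \<in> carrier (relative_homology_group p C {Apex})"
    and "hom_induced p C {Apex} C cap id z = hom_induced p (subtopology C body) collar C cap id w"
  shows "of_body p w = z"
  using Apex_cap_iso[of p] assms(1) unfolding of_body_def assms(2)[symmetric]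
  by (simp add: iso_def bij_betw_def)

lemma cap_of_body:
  "hom_induced p C {Apex} C cap id (of_body p w) = hom_induced p (subtopology C body) collar C cap id w"
  unfolding of_body_def using Apex_cap_iso[of p] hom_induced_carrier
  by (intro f_inv_into_f) (simp add: iso_def bij_betw_def)

lemma to_body_of_body:
  assumes "w \<in> carrier (relative_homology_group p (subtopology C body) collar)"
  shows "to_body p (of_body p w) = w"
  using excision_iso[of p] assms unfolding to_body_def cap_of_body
  by (simp add: iso_def bij_betw_def)

lemma connecting_of_body:
  assumes "w \<in> carrier (relative_homology_group p (subtopology C body) collar)"
  shows "connecting p (of_body p w) =
    hom_induced (p - 1) (subtopology C collar) {} X {} mid_fst (hom_boundary p (subtopology C body) collar w)"
  by (simp add: connecting_def to_body_of_body[OF assms])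

lemma connecting_hom: "connecting p \<in> hom (relative_homology_group p C {Apex}) (homology_group (p - 1) X)"
proof -
  have 1: "to_body p \<in> hom (relative_homology_group p C {Apex}) (relative_homology_group p (subtopology C body) collar)"
    using to_body_iso by (simp add: iso_def)
  have 2: "hom_boundary p (subtopology C body) collar
      \<in> hom (relative_homology_group p (subtopology C body) collar) (homology_group (p - 1) (subtopology C collar))"
    using hom_boundary_hom[of p "subtopology C body" collar] by (simp only: subtopology_body_collar)
  have "hom_induced (p - 1) (subtopology C collar) {} X {} mid_fst
      \<circ> hom_boundary p (subtopology C body) collar \<circ> to_body p
      \<in> hom (relative_homology_group p C {Apex}) (homology_group (p - 1) X)"
    by (rule hom_compose[OF 1 hom_compose[OF 2 hom_induced_hom]])
  then show ?thesis by (simp add: connecting_def[abs_def] o_def)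
qed

text \<open>
  On the collar both routes to \<open>Y\<close> forget the height and apply \<open>h\<close>. This is why \<open>h\<close>
  takes the place of the inclusion of the collar into the body.
\<close>
lemma h_mid_fst:
  "hom_induced p X {} Y {} h (hom_induced p (subtopology C collar) {} X {} mid_fst a) =
   hom_induced p (subtopology C body) {} Y {} retract
     (hom_induced p (subtopology C collar) {} (subtopology C body) {} id a)"
proof -
  have "continuous_map (subtopology C collar) (subtopology C body) id"
    using collar_subset_body by (simp add: continuous_map_from_subtopology_mono[of _ body] flip: id_def)
  then have "hom_induced p (subtopology C body) {} Y {} retract
     (hom_induced p (subtopology C collar) {} (subtopology C body) {} id a)
     = hom_induced p (subtopology C collar) {} Y {} (retract \<circ> id) a"
    by (intro hom_induced_compose') (auto simp: continuous_retract)
  also have "hom_induced p (subtopology C collar) {} Y {} (retract \<circ> id)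
      = hom_induced p (subtopology C collar) {} Y {} (h \<circ> mid_fst)"
    by (rule hom_induced_eq) (auto simp: collar_eq)
  also have "\<dots> a = hom_induced p X {} Y {} h (hom_induced p (subtopology C collar) {} X {} mid_fst a)"
    by (intro hom_induced_compose'[symmetric]) (auto simp: continuous_mid_fst continuous_h)
  finally show ?thesis by (rule sym)
qed

text \<open>
  Both sides become the class of \<open>b\<close> in \<open>H_p(C, cap)\<close>, on the left because \<open>Base\<close> inverts the retraction
  on homology.
\<close>
lemma cone_incl_retract:
  assumes "b \<in> carrier (homology_group p (subtopology C body))"
  shows "cone_incl p (hom_induced p (subtopology C body) {} Y {} retract b) =
    of_body p (hom_induced p (subtopology C body) {} (subtopology C body) collar id b)"
proof (rule of_body_eqI[symmetric])
  let ?y = "hom_induced p (subtopology C body) {} Y {} retract b"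
  have id: "continuous_map (subtopology C body) C id"
    by (simp add: continuous_map_from_subtopology)
  have "hom_induced p C {Apex} C cap id (cone_incl p ?y) = hom_induced p Y {} C cap (id \<circ> Base) ?y"
    by (intro hom_induced_compose') (auto simp: continuous_Base Apex_in_cap)
  also have "\<dots> = hom_induced p (subtopology C body) {} C cap id (hom_induced p Y {} (subtopology C body) {} Base ?y)"
    by (intro hom_induced_compose'[symmetric]) (auto simp: continuous_Base_body id)
  also have "hom_induced p Y {} (subtopology C body) {} Base ?y = b"
    using retract_group_isomorphisms[of p] assms by (simp add: group_isomorphisms_def)
  also have "hom_induced p (subtopology C body) {} C cap id b = hom_induced p (subtopology C body) {} C cap (id \<circ> id) b"
    by simp
  also have "\<dots> = hom_induced p (subtopology C body) collar C cap id
      (hom_induced p (subtopology C body) {} (subtopology C body) collar id b)"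
    using collar_subset_cap by (intro hom_induced_compose'[symmetric]) (auto simp: id)
  finally show "hom_induced p C {Apex} C cap id (cone_incl p ?y) = hom_induced p (subtopology C body) collar C cap id
      (hom_induced p (subtopology C body) {} (subtopology C body) collar id b)" .
qed (rule hom_induced_carrier)

lemma retract_iso:
  "hom_induced p (subtopology C body) {} Y {} retract
    \<in> iso (homology_group p (subtopology C body)) (homology_group p Y)"
  by (rule group_isomorphisms_imp_iso[OF retract_group_isomorphisms])

text \<open>
  Exactness at \<open>H_p(Y)\<close>, and in the next two lemmas at \<open>H_p(C, Apex)\<close> and \<open>H_(p-1)(X)\<close>, comes from exactness
  of the sequence of \<open>(body, collar)\<close> along the isomorphisms \<open>mid_fst_iso\<close>, \<open>retract_iso\<close> and \<open>of_body_iso\<close>.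
\<close>
lemma puppe_exact_base:
  "hom_induced p X {} Y {} h ` carrier (homology_group p X)
    = kernel (homology_group p Y) (relative_homology_group p C {Apex}) (cone_incl p)"
proof (rule exact_at_transport[OF
      exact_seq_image_eq_kernel[OF homology_exactness_axiom_3[of p "subtopology C body" collar]]
      _ retract_iso iso_imp_mon[OF of_body_iso] hom_induced_hom])
  show "hom_induced p (subtopology C collar) {} X {} mid_fst
      ` carrier (homology_group p (subtopology (subtopology C body) collar)) = carrier (homology_group p X)"
    by (simp only: subtopology_body_collar iso_imp_image[OF mid_fst_iso])
qed (simp_all add: subtopology_body_collar h_mid_fst cone_incl_retract)

lemma puppe_exact_cone:
  "cone_incl p ` carrier (homology_group p Y)
    = kernel (relative_homology_group p C {Apex}) (homology_group (p - 1) X) (connecting p)"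
proof (rule exact_at_transport[OF
      exact_seq_image_eq_kernel[OF homology_exactness_axiom_1[of p "subtopology C body" collar]]
      iso_imp_image[OF retract_iso] of_body_iso _ hom_boundary_hom])
  show "hom_induced (p - 1) (subtopology C collar) {} X {} mid_fst
      \<in> mon (homology_group (p - 1) (subtopology (subtopology C body) collar)) (homology_group (p - 1) X)"
    by (simp only: subtopology_body_collar iso_imp_mon[OF mid_fst_iso])
qed (simp_all add: connecting_of_body cone_incl_retract)

lemma puppe_exact_source:
  "connecting p ` carrier (relative_homology_group p C {Apex})
    = kernel (homology_group (p - 1) X) (homology_group (p - 1) Y) (hom_induced (p - 1) X {} Y {} h)"
proof (rule exact_at_transport[OF
      exact_seq_image_eq_kernel[OF homology_exactness_axiom_2[of p "subtopology C body" collar]]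
      iso_imp_image[OF of_body_iso] _ iso_imp_mon[OF retract_iso] hom_induced_hom])
  show "hom_induced (p - 1) (subtopology C collar) {} X {} mid_fst
      \<in> iso (homology_group (p - 1) (subtopology (subtopology C body) collar)) (homology_group (p - 1) X)"
    by (simp only: subtopology_body_collar mid_fst_iso)
qed (simp_all add: connecting_of_body h_mid_fst subtopology_body_collar)

lemma puppe_short_exact:
  "is_short_exact
    (homology_group p Y Mod (hom_induced p X {} Y {} h ` carrier (homology_group p X)))
    (relative_homology_group p C {Apex})
    (subgroup_generated (homology_group (p - 1) X)
      (kernel (homology_group (p - 1) X) (homology_group (p - 1) Y) (hom_induced (p - 1) X {} Y {} h)))
    (\<lambda>S. the_elem (cone_incl p ` S)) (connecting p)"
  by (rule short_exact_of_five_term[OF _ _ _ _ _ hom_induced_hom hom_induced_hom connecting_hom hom_induced_hom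
        puppe_exact_base puppe_exact_cone puppe_exact_source]) simp_all

text \<open>The universal property of the cone as a quotient.\<close>
lemma continuous_map_from_cone:
  assumes "continuous_map Y Z (g \<circ> Base)"
    and "continuous_map (prod_topology X (top_of_set {0..1})) Z (g \<circ> cone_glue h)"
    and "g Apex \<in> topspace Z"
  shows "continuous_map C Z g"
  unfolding continuous_map_def
proof (intro conjI allI impI)
  show "g \<in> topspace C \<rightarrow> topspace Z"
  proof
    fix p assume "p \<in> topspace C"
    then consider y where "p = Base y" "y \<in> topspace Y" | "p = Apex"
      | x t where "p = Mid x t" "x \<in> topspace X" "0 < t" "t < 1"
      by (auto simp: topspace_C cone_points_def)
    then show "g p \<in> topspace Z"
    proof cases
      case (1 y)
      then show ?thesis using assms(1) by (auto simp: continuous_map_def Pi_iff)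
    next
      case (3 x t)
      then have "(g \<circ> cone_glue h) (x, t) \<in> topspace Z"
        using assms(2) by (intro continuous_map_image_subset_topspace[THEN subsetD]) auto
      then show ?thesis using 3 by (simp add: cone_glue_def)
    qed (simp add: assms(3))
  qed
  fix U assume U: "openin Z U"
  let ?P = "{p \<in> topspace C. g p \<in> U}"
  show "openin C ?P"
    unfolding openin_C
  proof (intro conjI)
    have "{y \<in> topspace Y. Base y \<in> ?P} = {y \<in> topspace Y. (g \<circ> Base) y \<in> U}"
      by (auto simp: topspace_C cone_points_def)
    then show "openin Y {y \<in> topspace Y. Base y \<in> ?P}"
      using openin_continuous_map_preimage[OF assms(1) U] by (simp only:)
    have "{q \<in> topspace X \<times> {0..1}. cone_glue h q \<in> ?P}
        = {q \<in> topspace (prod_topology X (top_of_set {0..1})). (g \<circ> cone_glue h) q \<in> U}"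
      using cone_glue_in_cone_points[OF h_in] by (auto simp: topspace_C)
    then show "openin (prod_topology X (top_of_set {0..1})) {q \<in> topspace X \<times> {0..1}. cone_glue h q \<in> ?P}"
      using openin_continuous_map_preimage[OF assms(2) U] by (simp only:)
  qed blast
qed

end

section \<open>Naturality of the exact sequence\<close>

locale cone_square = source: cone_map X Y h + target: cone_map X' Y' h'
  for X :: "'x topology" and Y :: "'y topology" and h
    and X' :: "'x' topology" and Y' :: "'y' topology" and h' +
  fixes \<alpha> :: "'x \<Rightarrow> 'x'" and \<beta> :: "'y \<Rightarrow> 'y'"
  assumes continuous_\<alpha>: "continuous_map X X' \<alpha>" and continuous_\<beta>: "continuous_map Y Y' \<beta>"
    and commutes: "\<And>x. x \<in> topspace X \<Longrightarrow> \<beta> (h x) = h' (\<alpha> x)"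
begin

abbreviation \<kappa> :: "('x, 'y) cone_pt \<Rightarrow> ('x', 'y') cone_pt" where "\<kappa> \<equiv> map_cone_pt \<alpha> \<beta>"

lemma \<kappa>_cone_glue: "x \<in> topspace X \<Longrightarrow> \<kappa> (cone_glue h (x, t)) = cone_glue h' (\<alpha> x, t)"
  by (simp add: cone_glue_def commutes)

lemma \<alpha>_in: "x \<in> topspace X \<Longrightarrow> \<alpha> x \<in> topspace X'"
  and \<beta>_in: "y \<in> topspace Y \<Longrightarrow> \<beta> y \<in> topspace Y'"
  using continuous_\<alpha> continuous_\<beta> by (auto simp: continuous_map_def)

lemma continuous_\<kappa>: "continuous_map source.C target.C \<kappa>"
proof (rule source.continuous_map_from_cone)
  have "\<kappa> \<circ> Base = Base \<circ> \<beta>" by auto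
  then show "continuous_map Y target.C (\<kappa> \<circ> Base)"
    using continuous_map_compose[OF continuous_\<beta> target.continuous_Base] by simp
  let ?I = "top_of_set {0..1::real}"
  have "continuous_map (prod_topology X ?I) (prod_topology X' ?I) (\<lambda>(x, t). (\<alpha> x, id t))"
    unfolding continuous_map_prod_top using continuous_\<alpha> by (simp add: id_def)
  from continuous_map_compose[OF this target.continuous_cone_glue]
  show "continuous_map (prod_topology X ?I) target.C (\<kappa> \<circ> cone_glue h)"
    by (rule continuous_map_eq) (auto simp: \<kappa>_cone_glue)
qed (simp add: target.topspace_C cone_points_def)

lemma \<kappa>_body: "\<kappa> \<in> source.body \<rightarrow> target.body"
  and \<kappa>_cap: "\<kappa> \<in> source.cap \<rightarrow> target.cap"
  and \<kappa>_collar: "\<kappa> \<in> source.collar \<rightarrow> target.collar"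
  using \<alpha>_in \<beta>_in
  by (auto simp: source.body_eq target.body_eq source.cap_eq target.cap_eq source.collar_eq target.collar_eq)

lemma continuous_\<kappa>_body: "continuous_map (subtopology source.C source.body) (subtopology target.C target.body) \<kappa>"
  and continuous_\<kappa>_collar: "continuous_map (subtopology source.C source.collar) (subtopology target.C target.collar) \<kappa>"
  using continuous_\<kappa> \<kappa>_body \<kappa>_collar
  by (auto simp: continuous_map_in_subtopology continuous_map_from_subtopology)

lemma cone_incl_natural:
  "hom_induced p source.C {Apex} target.C {Apex} \<kappa> (source.cone_incl p y)
    = target.cone_incl p (hom_induced p Y {} Y' {} \<beta> y)"
proof -
  have "hom_induced p source.C {Apex} target.C {Apex} \<kappa> (source.cone_incl p y)
      = hom_induced p Y {} target.C {Apex} (\<kappa> \<circ> Base) y"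
    by (intro hom_induced_compose') (auto simp: continuous_\<kappa> source.continuous_Base)
  also have "\<kappa> \<circ> Base = Base \<circ> \<beta>" by auto
  also have "hom_induced p Y {} target.C {Apex} (Base \<circ> \<beta>) y = target.cone_incl p (hom_induced p Y {} Y' {} \<beta> y)"
    by (intro hom_induced_compose'[symmetric]) (auto simp: continuous_\<beta> target.continuous_Base)
  finally show ?thesis .
qed

text \<open>
  By exactness \<open>cone_incl\<close> kills the subgroup divided out, so on both sides it takes a single value on each coset,
  and the values can be compared on one representative.
\<close>
lemma cone_incl_quotient_natural:
  assumes S: "S \<in> carrier (homology_group p Y Mod (hom_induced p X {} Y {} h ` carrier (homology_group p X)))"
  shows "the_elem (target.cone_incl p `
        ((hom_induced p X' {} Y' {} h' ` carrier (homology_group p X'))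
          <#>\<^bsub>homology_group p Y'\<^esub> (hom_induced p Y {} Y' {} \<beta> ` S)))
    = hom_induced p source.C {Apex} target.C {Apex} \<kappa> (the_elem (source.cone_incl p ` S))"
proof -
  interpret src: group_hom "homology_group p Y" "relative_homology_group p source.C {Apex}" "source.cone_incl p"
    by (simp add: group_hom_def group_hom_axioms_def hom_induced_hom)
  interpret tgt: group_hom "homology_group p Y'" "relative_homology_group p target.C {Apex}" "target.cone_incl p"
    by (simp add: group_hom_def group_hom_axioms_def hom_induced_hom)
  let ?K' = "kernel (homology_group p Y') (relative_homology_group p target.C {Apex}) (target.cone_incl p)"
  let ?\<kappa> = "hom_induced p source.C {Apex} target.C {Apex} \<kappa>" and ?\<beta> = "hom_induced p Y {} Y' {} \<beta>"
  obtain y where y: "source.cone_incl p ` S = {y}"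
    using S src.image_kernel_coset unfolding source.puppe_exact_base
    by (auto simp: FactGroup_def RCOSETS_def)
  have "target.cone_incl p (k \<otimes>\<^bsub>homology_group p Y'\<^esub> ?\<beta> z) = ?\<kappa> y" if "k \<in> ?K'" "z \<in> S" for k z
  proof -
    have "target.cone_incl p (k \<otimes>\<^bsub>homology_group p Y'\<^esub> ?\<beta> z) = target.cone_incl p (?\<beta> z)"
      using that(1) by (simp add: kernel_def hom_induced_carrier)
    also have "\<dots> = ?\<kappa> (source.cone_incl p z)" by (rule cone_incl_natural[symmetric])
    also have "source.cone_incl p z = y" using y that(2) by blast
    finally show ?thesis .
  qed
  moreover have "\<one>\<^bsub>homology_group p Y'\<^esub> \<in> ?K'" by (simp add: kernel_def)
  moreover have "S \<noteq> {}" using y by blast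
  ultimately have "target.cone_incl p ` (?K' <#>\<^bsub>homology_group p Y'\<^esub> (?\<beta> ` S)) = {?\<kappa> y}"
    unfolding set_mult_def by blast
  then show ?thesis by (simp add: target.puppe_exact_base y)
qed

text \<open>
  The two sides are compared in \<open>H_p(C', cap')\<close>, into which \<open>H_p(C', Apex)\<close> embeds and where both are induced
  by \<open>\<kappa>\<close>.
\<close>
lemma of_body_natural:
  "hom_induced p source.C {Apex} target.C {Apex} \<kappa> (source.of_body p w)
    = target.of_body p (hom_induced p (subtopology source.C source.body) source.collar
        (subtopology target.C target.body) target.collar \<kappa> w)"
proof (rule target.of_body_eqI[symmetric])
  have src: "continuous_map (subtopology source.C source.body) source.C id"
    and tgt: "continuous_map (subtopology target.C target.body) target.C id"
    by (simp_all add: continuous_map_from_subtopology)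
  have "hom_induced p target.C {Apex} target.C target.cap id
      (hom_induced p source.C {Apex} target.C {Apex} \<kappa> (source.of_body p w))
    = hom_induced p source.C {Apex} target.C target.cap (id \<circ> \<kappa>) (source.of_body p w)"
    by (intro hom_induced_compose') (auto simp: continuous_\<kappa> target.Apex_in_cap)
  also have "id \<circ> \<kappa> = \<kappa> \<circ> id" by simp
  also have "hom_induced p source.C {Apex} target.C target.cap (\<kappa> \<circ> id) (source.of_body p w)
    = hom_induced p source.C source.cap target.C target.cap \<kappa>
        (hom_induced p source.C {Apex} source.C source.cap id (source.of_body p w))"
    using \<kappa>_cap by (intro hom_induced_compose'[symmetric]) (auto simp: continuous_\<kappa> source.Apex_in_cap)
  also have "\<dots> = hom_induced p source.C source.cap target.C target.cap \<kappa>
      (hom_induced p (subtopology source.C source.body) source.collar source.C source.cap id w)"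
    by (simp only: source.cap_of_body)
  also have "\<dots> = hom_induced p (subtopology source.C source.body) source.collar target.C target.cap (\<kappa> \<circ> id) w"
    using \<kappa>_cap source.collar_subset_cap src by (intro hom_induced_compose') (auto simp: continuous_\<kappa>)
  also have "\<kappa> \<circ> id = id \<circ> \<kappa>" by simp
  also have "hom_induced p (subtopology source.C source.body) source.collar target.C target.cap (id \<circ> \<kappa>) w
    = hom_induced p (subtopology target.C target.body) target.collar target.C target.cap id
       (hom_induced p (subtopology source.C source.body) source.collar
        (subtopology target.C target.body) target.collar \<kappa> w)"
    using \<kappa>_collar target.collar_subset_cap tgt
    by (intro hom_induced_compose'[symmetric]) (auto simp: continuous_\<kappa>_body)
  finally show "hom_induced p target.C {Apex} target.C target.cap id
      (hom_induced p source.C {Apex} target.C {Apex} \<kappa> (source.of_body p w))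
    = hom_induced p (subtopology target.C target.body) target.collar target.C target.cap id
       (hom_induced p (subtopology source.C source.body) source.collar
        (subtopology target.C target.body) target.collar \<kappa> w)" .
qed (rule hom_induced_carrier)

text \<open>
  Writing \<open>z\<close> as a class of the pair \<open>(body, collar)\<close> reduces this to naturality of the boundary map and to the
  fact that \<open>\<kappa>\<close> acts on the collar as \<open>\<alpha>\<close> on the first coordinate.
\<close>
lemma connecting_natural:
  assumes "z \<in> carrier (relative_homology_group p source.C {Apex})"
  shows "target.connecting p (hom_induced p source.C {Apex} target.C {Apex} \<kappa> z)
    = hom_induced (p - 1) X {} X' {} \<alpha> (source.connecting p z)"
proof -
  let ?B = "subtopology source.C source.body" and ?B' = "subtopology target.C target.body"
  let ?Z = "subtopology source.C source.collar" and ?Z' = "subtopology target.C target.collar"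
  obtain w where w: "w \<in> carrier (relative_homology_group p ?B source.collar)" and z: "z = source.of_body p w"
    using assms iso_imp_image[OF source.of_body_iso[of p]] by blast
  let ?w = "hom_induced p ?B source.collar ?B' target.collar \<kappa> w"
  have "target.connecting p (hom_induced p source.C {Apex} target.C {Apex} \<kappa> z)
      = hom_induced (p - 1) ?Z' {} X' {} mid_fst (hom_boundary p ?B' target.collar ?w)"
    unfolding z of_body_natural by (rule target.connecting_of_body[OF hom_induced_carrier])
  also have "hom_boundary p ?B' target.collar ?w
      = hom_induced (p - 1) ?Z {} ?Z' {} \<kappa> (hom_boundary p ?B source.collar w)"
    using fun_cong[OF naturality_hom_induced[OF continuous_\<kappa>_body \<kappa>_collar], of p w]
    by (simp add: source.subtopology_body_collar target.subtopology_body_collar)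
  also have "hom_induced (p - 1) ?Z' {} X' {} mid_fst \<dots>
      = hom_induced (p - 1) ?Z {} X' {} (mid_fst \<circ> \<kappa>) (hom_boundary p ?B source.collar w)"
    by (intro hom_induced_compose') (auto simp: continuous_\<kappa>_collar target.continuous_mid_fst)
  also have "hom_induced (p - 1) ?Z {} X' {} (mid_fst \<circ> \<kappa>) = hom_induced (p - 1) ?Z {} X' {} (\<alpha> \<circ> mid_fst)"
    by (rule hom_induced_eq) (auto simp: source.collar_eq)
  also have "\<dots> (hom_boundary p ?B source.collar w)
      = hom_induced (p - 1) X {} X' {} \<alpha> (hom_induced (p - 1) ?Z {} X {} mid_fst (hom_boundary p ?B source.collar w))"
    by (intro hom_induced_compose'[symmetric]) (auto simp: continuous_\<alpha> source.continuous_mid_fst)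
  also have "hom_induced (p - 1) ?Z {} X {} mid_fst (hom_boundary p ?B source.collar w) = source.connecting p z"
    unfolding z by (rule source.connecting_of_body[OF w, symmetric])
  finally show ?thesis .
qed

end

section \<open>Classifying spaces\<close>

lemma classifying_map_compose:
  assumes f: "f \<in> hom \<Gamma> G" and \<psi>: "\<psi> \<in> hom G G'" and grp: "group \<Gamma>" "group G" "group G'"
    and p: "p \<in> topspace (bar_space \<Gamma>)"
  shows "classifying_map G' \<psi> (classifying_map G f (bar_class \<Gamma> p)) =
    bar_class G' (map_prod (map (\<psi> \<circ> f)) id p)"
proof -
  have "map_prod (map f) id p \<in> topspace (bar_space G)"
    using p hom_in_carrier[OF f] by (auto simp: topspace_bar_space)
  then show ?thesis
    using classifying_map_bar_class[OF f grp(1,2) p] classifying_map_bar_class[OF \<psi> grp(2,3)]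
    by (simp add: map_prod.compositionality flip: map_prod.comp)
qed

lemma classifying_map_square:
  assumes hom: "f \<in> hom \<Gamma> G" "\<psi> \<in> hom G G'" "\<phi> \<in> hom \<Gamma> \<Gamma>'" "f' \<in> hom \<Gamma>' G'"
    and grp: "group \<Gamma>" "group G" "group \<Gamma>'" "group G'"
    and commutes: "\<forall>x\<in>carrier \<Gamma>. \<psi> (f x) = f' (\<phi> x)"
    and c: "c \<in> topspace (classifying_space \<Gamma>)"
  shows "classifying_map G' \<psi> (classifying_map G f c) = classifying_map G' f' (classifying_map \<Gamma>' \<phi> c)"
proof -
  obtain gs t where p: "(gs, t) \<in> topspace (bar_space \<Gamma>)" "c = bar_class \<Gamma> (gs, t)"
    using c by (auto simp: classifying_space_def)
  then have eq: "map (\<psi> \<circ> f) gs = map (f' \<circ> \<phi>) gs"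
    using commutes by (auto simp: topspace_bar_space)
  then show ?thesis
    using classifying_map_compose[OF hom(1,2) grp(1,2,4) p(1)]
      classifying_map_compose[OF hom(3,4) grp(1,3,4) p(1)]
    by (simp only: p(2) map_prod_simp id_apply eq)
qed

lemma cone_map_classifying_map:
  assumes "group \<Gamma>" "group G" "f \<in> hom \<Gamma> G"
  shows "cone_map (classifying_space \<Gamma>) (classifying_space G) (classifying_map G f)"
  using continuous_map_classifying_map[OF assms(3,1,2)] by (rule cone_map.intro)

lemma H2_connecting_eq:
  assumes "group \<Gamma>" "group G" "f \<in> hom \<Gamma> G"
  shows "H2_connecting \<Gamma> G f =
    cone_map.connecting (classifying_space \<Gamma>) (classifying_space G) (classifying_map G f) 2"
proof -
  interpret cone_map "classifying_space \<Gamma>" "classifying_space G" "classifying_map G f"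
    by (rule cone_map_classifying_map[OF assms])
  show ?thesis
    by (rule ext) (simp add: H2_connecting_def connecting_def to_body_def collar_def body_def cap_def
        group_cone_def Let_def)
qed

theorem proposition5p1:
  fixes \<Gamma> :: "('a, 'm) monoid_scheme" and G :: "('b, 'n) monoid_scheme" and f :: "'a \<Rightarrow> 'b"
  assumes "group \<Gamma>" and "group G" and "f \<in> hom \<Gamma> G"
  shows
    "is_short_exact (H2_coker \<Gamma> G f) (rel_group_homology 2 \<Gamma> G f) (H1_ker \<Gamma> G f)
       (H2_coker_incl \<Gamma> G f) (H2_connecting \<Gamma> G f)
     \<and> (\<forall>(\<Gamma>' :: ('c, 'k) monoid_scheme) (G' :: ('d, 'l) monoid_scheme) f' \<phi> \<psi>.
          group \<Gamma>' \<and> group G' \<and> f' \<in> hom \<Gamma>' G' \<and> \<phi> \<in> hom \<Gamma> \<Gamma>' \<and> \<psi> \<in> hom G G' \<and>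
          (\<forall>x\<in>carrier \<Gamma>. \<psi> (f x) = f' (\<phi> x)) \<longrightarrow>
          (\<forall>S\<in>carrier (H2_coker \<Gamma> G f).
             H2_coker_incl \<Gamma>' G' f' (H2_coker_map G \<Gamma>' G' f' \<psi> S) =
             rel_group_homology_map 2 \<Gamma> G f \<Gamma>' G' f' \<phi> \<psi> (H2_coker_incl \<Gamma> G f S)) \<and>
          (\<forall>z\<in>carrier (rel_group_homology 2 \<Gamma> G f).
             H2_connecting \<Gamma>' G' f' (rel_group_homology_map 2 \<Gamma> G f \<Gamma>' G' f' \<phi> \<psi> z) =
             group_homology_map 1 \<Gamma> \<Gamma>' \<phi> (H2_connecting \<Gamma> G f z)))
     \<and> (inj_on (group_homology_map 1 \<Gamma> G f) (carrier (group_homology 1 \<Gamma>)) \<longrightarrow>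
          H2_coker_incl \<Gamma> G f \<in> iso (H2_coker \<Gamma> G f) (rel_group_homology 2 \<Gamma> G f))"
proof -
  interpret cone: cone_map "classifying_space \<Gamma>" "classifying_space G" "classifying_map G f"
    by (rule cone_map_classifying_map[OF assms])
  have exact: "is_short_exact (H2_coker \<Gamma> G f) (rel_group_homology 2 \<Gamma> G f) (H1_ker \<Gamma> G f)
       (H2_coker_incl \<Gamma> G f) (H2_connecting \<Gamma> G f)"
    using cone.puppe_short_exact[of 2]
    by (simp add: H2_connecting_eq[OF assms] H2_coker_def H1_ker_def rel_group_homology_def
        H2_coker_incl_def[abs_def] group_homology_def group_homology_map_def group_cone_def)
  have natural: "(\<forall>S\<in>carrier (H2_coker \<Gamma> G f).
             H2_coker_incl \<Gamma>' G' f' (H2_coker_map G \<Gamma>' G' f' \<psi> S) =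
             rel_group_homology_map 2 \<Gamma> G f \<Gamma>' G' f' \<phi> \<psi> (H2_coker_incl \<Gamma> G f S)) \<and>
          (\<forall>z\<in>carrier (rel_group_homology 2 \<Gamma> G f).
             H2_connecting \<Gamma>' G' f' (rel_group_homology_map 2 \<Gamma> G f \<Gamma>' G' f' \<phi> \<psi> z) =
             group_homology_map 1 \<Gamma> \<Gamma>' \<phi> (H2_connecting \<Gamma> G f z))"
    if "group \<Gamma>' \<and> group G' \<and> f' \<in> hom \<Gamma>' G' \<and> \<phi> \<in> hom \<Gamma> \<Gamma>' \<and> \<psi> \<in> hom G G' \<and>
          (\<forall>x\<in>carrier \<Gamma>. \<psi> (f x) = f' (\<phi> x))"
    for \<Gamma>' :: "('c, 'k) monoid_scheme" and G' :: "('d, 'l) monoid_scheme" and f' \<phi> \<psi>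
  proof -
    have grp': "group \<Gamma>'" "group G'" and hom': "f' \<in> hom \<Gamma>' G'" "\<phi> \<in> hom \<Gamma> \<Gamma>'" "\<psi> \<in> hom G G'"
      and commutes: "\<forall>x\<in>carrier \<Gamma>. \<psi> (f x) = f' (\<phi> x)"
      using that by blast+
    interpret cone': cone_map "classifying_space \<Gamma>'" "classifying_space G'" "classifying_map G' f'"
      by (rule cone_map_classifying_map[OF grp' hom'(1)])
    interpret square: cone_square "classifying_space \<Gamma>" "classifying_space G" "classifying_map G f"
        "classifying_space \<Gamma>'" "classifying_space G'" "classifying_map G' f'"
        "classifying_map \<Gamma>' \<phi>" "classifying_map G' \<psi>"
    proof
      show "continuous_map (classifying_space \<Gamma>) (classifying_space \<Gamma>') (classifying_map \<Gamma>' \<phi>)"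
        by (rule continuous_map_classifying_map[OF hom'(2) assms(1) grp'(1)])
      show "continuous_map (classifying_space G) (classifying_space G') (classifying_map G' \<psi>)"
        by (rule continuous_map_classifying_map[OF hom'(3) assms(2) grp'(2)])
      show "classifying_map G' \<psi> (classifying_map G f c) = classifying_map G' f' (classifying_map \<Gamma>' \<phi> c)"
        if "c \<in> topspace (classifying_space \<Gamma>)" for c
        by (rule classifying_map_square[OF assms(3) hom'(3,2,1) assms(1,2) grp' commutes that])
    qed
    show ?thesis
      using square.cone_incl_quotient_natural[of _ 2] square.connecting_natural[of _ 2]
      by (simp add: H2_connecting_eq[OF assms] H2_connecting_eq[OF grp' hom'(1)] H2_coker_def
          rel_group_homology_def rel_group_homology_map_def H2_coker_map_def H2_coker_incl_def
          group_homology_def group_homology_map_def group_cone_def)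
  qed
  have "H2_coker_incl \<Gamma> G f \<in> iso (H2_coker \<Gamma> G f) (rel_group_homology 2 \<Gamma> G f)"
    if inj: "inj_on (group_homology_map 1 \<Gamma> G f) (carrier (group_homology 1 \<Gamma>))"
  proof (rule iso_of_short_exact[OF exact])
    interpret h: group_hom "group_homology 1 \<Gamma>" "group_homology 1 G" "group_homology_map 1 \<Gamma> G f"
      by (simp add: group_hom_def group_hom_axioms_def group_homology_def group_homology_map_def hom_induced_hom)
    show "carrier (H1_ker \<Gamma> G f) = {\<one>\<^bsub>H1_ker \<Gamma> G f\<^esub>}"
      using inj h.subgroup_kernel
      by (simp add: H1_ker_def h.inj_iff_trivial_ker subgroup.carrier_subgroup_generated_subgroup)
  qed
  with exact natural show ?thesis by blast
qed

end
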